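(* Consider the problem of minimizing $f(x)$ subject to $Ax=b$, $x\in P$, where $f:\mathbb{R}^n\to\mathbb{R}$ is differentiable (not necessarily convex), $A\in\mathbb{R}^{m\times n}$, $b\in\mathbb{R}^m$, and $P=\{x\in\mathbb{R}^n: \ell_i\le x_i\le u_i,\ i=1,\dots,n\}$ is a bounded box with $\ell_i<u_i$ for all $i$. Suppose that (a) the origin is in the relative interior of $\{Ax-b:x\in P\}$; (b) the strict complementarity condition holds; (c) $\|\nabla f(x)-\nabla f(x')\|\le L\|x-x'\|$ for all $x,x'\in P$, for some $L>0$. Let $\gamma\in\mathbb{R}$ satisfy $\langle\nabla f(x)-\nabla f(x'),x-x'\rangle\ge\gamma\|x-x'\|^2$ for all $x,x'\in P$, let $\Gamma>0$, $p>0$ with $p>-\gamma$, $L_K=L+p+\Gamma\sigma^2$ ($\sigma$ the spectral norm of $A$) and $0<c<1/L_K$. Let $\{(x^t,y^t,z^t)\}$ be generated by the proximal inexact augmented Lagrangian multiplier method with these parameters and sufficiently small stepsizes $\alpha,\beta$ (that is, $\alpha\in(0,\alpha_0)$ for a suitable $\alpha_0>0$, and then $\beta\in(0,\beta_0)$ for a suitable $\beta_0>0$ that may depend on $\alpha$ and $y^0$). Then there exists a constant $B>0$ such that for every integer $t>0$ there is an $s\in\{0,1,\dots,t-1\}$ for which $(x^{s+1},y^{s+1})$ is a $B/\sqrt t$-solution of the problem. In other words, for every $\epsilon>0$ an $\epsilon$-solution can be found within $B^2/\epsilon^2$ iterations.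
   Context: $\|\cdot\|$ is the Euclidean norm and $[\cdot]_+$ is the Euclidean projection onto $P$. $\epsilon$-solution: let $\iota$ be the indicator function of $P$ ($\iota(x)=0$ for $x\in P$, $\iota(x)=\infty$ otherwise) and $\partial\iota$ its convex subdifferential. A pair $(x,y)$ is an $\epsilon$-solution if $\|Ax-b\|\le\epsilon$ and there is a vector $v\in\nabla f(x)+A^Ty+\partial\iota(x)$ with $\|v\|\le\epsilon$. KKT system: $(x,y,\mu,\nu)$ satisfies $\nabla f(x)+A^Ty-\mu+\nu=0$, $Ax=b$, $\ell_i\le x_i\le u_i$, $\mu_i\ge0$, $\nu_i\ge0$, $\mu_i(\ell_i-x_i)=0$, $\nu_i(x_i-u_i)=0$ for all $i$. Strict complementarity condition: for every solution of the KKT system and every $i$, exactly one of $\mu_i$ and $\ell_i-x_i$ is zero, and exactly one of $\nu_i$ and $x_i-u_i$ is zero. Let $K(x,z;y)=f(x)+y^T(Ax-b)+\frac{\Gamma}{2}\|Ax-b\|^2+\frac p2\|x-z\|^2$. Proximal inexact augmented Lagrangian multiplier method (parameters $\Gamma>0$, $p>0$, $\alpha>0$, $0<\beta\le1$, $0<c<1/L_K$): start from $x^0\in P$, $z^0\in P$, $y^0\in\mathbb{R}^m$; for $t=0,1,2,\dots$ set $y^{t+1}=y^t+\alpha(Ax^t-b)$, $x^{t+1}=[x^t-c\nabla_xK(x^t,z^t;y^{t+1})]_+$, $z^{t+1}=z^t+\beta(x^{t+1}-z^t)$. *)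

theory Defs
  imports "HOL-Analysis.Analysis"
begin

text \<open>Meaningful only at points of differentiability, where the gradient is unique.\<close>

definition grad :: "('a::real_inner \<Rightarrow> real) \<Rightarrow> 'a \<Rightarrow> 'a" where
  "grad h x = (THE D. GDERIV h x :> D)"

definition convex_indicator :: "'a set \<Rightarrow> 'a \<Rightarrow> ereal" where
  "convex_indicator P x = (if x \<in> P then 0 else \<infinity>)"

text \<open>For a proper function (such as the indicator of a nonempty set) this is
  empty at every point where the function is infinite.\<close>

definition subdifferential :: "('a::real_inner \<Rightarrow> ereal) \<Rightarrow> 'a \<Rightarrow> 'a set" where
  "subdifferential h x = {g. \<forall>z. h x + ereal (g \<bullet> (z - x)) \<le> h z}"

definition eps_solution ::
  "(real^'n \<Rightarrow> real) \<Rightarrow> real^'n^'m \<Rightarrow> real^'m \<Rightarrow> (real^'n) set \<Rightarrow> real \<Rightarrow> real^'n \<Rightarrow> real^'m \<Rightarrow> bool" where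
  "eps_solution f A b P \<epsilon> x y \<longleftrightarrow>
     norm (A *v x - b) \<le> \<epsilon> \<and>
     (\<exists>v \<in> {grad f x + transpose A *v y + g | g. g \<in> subdifferential (convex_indicator P) x}.
        norm v \<le> \<epsilon>)"

definition kkt ::
  "(real^'n \<Rightarrow> real) \<Rightarrow> real^'n^'m \<Rightarrow> real^'m \<Rightarrow> real^'n \<Rightarrow> real^'n \<Rightarrow>
   real^'n \<Rightarrow> real^'m \<Rightarrow> real^'n \<Rightarrow> real^'n \<Rightarrow> bool" where
  "kkt f A b l u x y \<mu> \<nu> \<longleftrightarrow>
     grad f x + transpose A *v y - \<mu> + \<nu> = 0 \<and>
     A *v x = b \<and>
     (\<forall>i. l $ i \<le> x $ i \<and> x $ i \<le> u $ i \<and>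
          0 \<le> \<mu> $ i \<and> 0 \<le> \<nu> $ i \<and>
          \<mu> $ i * (l $ i - x $ i) = 0 \<and>
          \<nu> $ i * (x $ i - u $ i) = 0)"

text \<open>Between propositions, \<open>\<noteq>\<close> is exclusive disjunction.\<close>

definition strict_complementarity ::
  "(real^'n \<Rightarrow> real) \<Rightarrow> real^'n^'m \<Rightarrow> real^'m \<Rightarrow> real^'n \<Rightarrow> real^'n \<Rightarrow> bool" where
  "strict_complementarity f A b l u \<longleftrightarrow>
     (\<forall>x y \<mu> \<nu>. kkt f A b l u x y \<mu> \<nu> \<longrightarrow>
        (\<forall>i. ((\<mu> $ i = 0) \<noteq> (l $ i - x $ i = 0)) \<and>
             ((\<nu> $ i = 0) \<noteq> (x $ i - u $ i = 0))))"

definition prox_aug_lagrangian ::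
  "(real^'n \<Rightarrow> real) \<Rightarrow> real^'n^'m \<Rightarrow> real^'m \<Rightarrow> real \<Rightarrow> real \<Rightarrow>
   real^'n \<Rightarrow> real^'n \<Rightarrow> real^'m \<Rightarrow> real" where
  "prox_aug_lagrangian f A b \<Gamma> p x z y =
     f x + y \<bullet> (A *v x - b) + \<Gamma> / 2 * (norm (A *v x - b))\<^sup>2 + p / 2 * (norm (x - z))\<^sup>2"

definition prox_inexact_alm ::
  "(real^'n \<Rightarrow> real) \<Rightarrow> real^'n^'m \<Rightarrow> real^'m \<Rightarrow> (real^'n) set \<Rightarrow>
   real \<Rightarrow> real \<Rightarrow> real \<Rightarrow> real \<Rightarrow> real \<Rightarrow>
   (nat \<Rightarrow> real^'n) \<Rightarrow> (nat \<Rightarrow> real^'m) \<Rightarrow> (nat \<Rightarrow> real^'n) \<Rightarrow> bool" where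
  "prox_inexact_alm f A b P \<Gamma> p c \<alpha> \<beta> x y z \<longleftrightarrow>
     x 0 \<in> P \<and> z 0 \<in> P \<and>
     (\<forall>t. y (Suc t) = y t + \<alpha> *\<^sub>R (A *v x t - b) \<and>
          x (Suc t) = closest_point P
            (x t - c *\<^sub>R grad (\<lambda>w. prox_aug_lagrangian f A b \<Gamma> p w (z t) (y (Suc t))) (x t)) \<and>
          z (Suc t) = z t + \<beta> *\<^sub>R (x (Suc t) - z t))"

end

theory Submission
  imports Defs
begin

text \<open>
  Let \<open>X y z\<close> minimize \<open>K(\<cdot>, z; y)\<close> over \<open>P\<close>, with value \<open>d(y, z)\<close>,
  and let \<open>Xs z\<close> minimize the proximal objective over the feasible set, with value \<open>M(z)\<close>.
  Along the iteration the potential \<open>\<phi> = K - 2 d + 2 M\<close> drops by at least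
  a positive multiple of \<open>\<parallel>x\<^sup>t\<^sup>+\<^sup>1 - x\<^sup>t\<parallel>\<^sup>2\<close>,
  \<open>\<parallel>A X - b\<parallel>\<^sup>2\<close> and \<open>\<parallel>x\<^sup>t\<^sup>+\<^sup>1 - z\<^sup>t\<parallel>\<^sup>2\<close>, up to an error term
  \<open>8 p \<beta> \<parallel>X - Xs\<parallel>\<^sup>2\<close>. For bounded multipliers this term is controlled by the residual
  \<open>A X - b\<close>: always through the Slater condition
  (\<open>\<parallel>X - Xs\<parallel>\<^sup>2 \<le> \<omega> \<parallel>A X - b\<parallel>\<close>), and, close to a KKT point, quadratically through
  strict complementarity, which identifies the active face. Hence the potential decreases; a bound on it
  bounds the multipliers by the Slater condition, so the argument closes by induction, and
  summing the decrease gives the rate.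
\<close>

section \<open>Averaging, and iteration counts from a rate\<close>

lemma exists_le_average:
  fixes a :: "nat \<Rightarrow> real"
  assumes "(\<Sum>s<t. a s) \<le> V" and "t > 0"
  shows "\<exists>s<t. a s \<le> V / real t"
proof (rule ccontr)
  assume "\<not> ?thesis"
  then have "(\<Sum>s<t. V / real t) < (\<Sum>s<t. a s)"
    using assms(2) by (intro sum_strict_mono) (auto simp: not_le)
  then show False
    using assms by simp
qed

text \<open>Running the rate for t = floor (\<open>B\<^sup>2 / \<epsilon>\<^sup>2\<close>) steps
  stays within the allowed index. Once t is at least 1, rounding down loses at most a factor 2. When
  t would be 0 the index must be 0, where the rate says nothing, so the starting pair has to serve;
  this is the purpose of \<open>init\<close>.\<close>

lemma iteration_complexity_of_rate:
  fixes E :: "nat \<Rightarrow> real \<Rightarrow> bool"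
  assumes mono: "\<And>k \<epsilon> \<epsilon>'. E k \<epsilon> \<Longrightarrow> \<epsilon> \<le> \<epsilon>' \<Longrightarrow> E k \<epsilon>'"
    and "C > 0" and rate: "\<And>t. t > 0 \<Longrightarrow> \<exists>s<t. E (Suc s) (C / sqrt (real t))"
    and init: "E 0 N"
  shows "\<exists>B>0. (\<forall>t>0. \<exists>s<t. E (Suc s) (B / sqrt (real t))) \<and>
    (\<forall>\<epsilon>>0. \<exists>k. real k \<le> B\<^sup>2 / \<epsilon>\<^sup>2 \<and> E k \<epsilon>)"
proof -
  \<comment> \<open>The factor 2 more than pays for the rounding. The maximum with \<open>N\<close>
    ensures that every \<epsilon> below \<open>N\<close> is also below \<open>B\<close>, so that at
    least one step is available.\<close>
  define B where "B = max (2 * C) N"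
  have "B > 0"
    using \<open>C > 0\<close> by (simp add: B_def)
  moreover have "\<exists>s<t. E (Suc s) (B / sqrt (real t))" if "t > 0" for t
  proof -
    obtain s where s: "s < t" "E (Suc s) (C / sqrt (real t))"
      using rate[OF \<open>t > 0\<close>] by blast
    moreover have "C / sqrt (real t) \<le> B / sqrt (real t)"
      using \<open>C > 0\<close> by (intro divide_right_mono) (auto simp: B_def)
    ultimately show ?thesis
      using mono by blast
  qed
  moreover have "\<exists>k. real k \<le> B\<^sup>2 / \<epsilon>\<^sup>2 \<and> E k \<epsilon>" if "\<epsilon> > 0" for \<epsilon>
  proof (cases "N \<le> \<epsilon>")
    case True
    then show ?thesis
      using mono[OF init] by (intro exI[of _ 0]) simp
  next
    case False
    define T where "T = B\<^sup>2 / \<epsilon>\<^sup>2"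
    define t where "t = nat \<lfloor>T\<rfloor>"
    have "B > \<epsilon>"
      using False by (simp add: B_def)
    then have "T \<ge> 1"
      using \<open>\<epsilon> > 0\<close> by (simp add: T_def power_mono)
    then have "t \<ge> 1" and t: "real t \<le> T" "real t > T - 1"
      unfolding t_def by (simp add: le_nat_iff, linarith+)
    then have t1: "real t \<ge> 1"
      by simp
    then obtain s where s: "s < t" "E (Suc s) (C / sqrt (real t))"
      using rate[of t] \<open>t \<ge> 1\<close> by auto
    have "T \<le> 2 * real t"
      using t(2) t1 by linarith
    then have "B\<^sup>2 \<le> 2 * (real t * \<epsilon>\<^sup>2)"
      using \<open>\<epsilon> > 0\<close> by (simp add: T_def divide_le_eq mult.assoc)
    moreover have "4 * C\<^sup>2 \<le> B\<^sup>2"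
      using power_mono[of "2 * C" B 2] \<open>C > 0\<close> by (simp add: B_def power_mult_distrib)
    ultimately have "C\<^sup>2 \<le> real t * \<epsilon>\<^sup>2"
      using zero_le_power2[of C] by linarith
    also have "\<dots> = (\<epsilon> * sqrt (real t))\<^sup>2"
      by (simp add: power_mult_distrib)
    finally have "C \<le> \<epsilon> * sqrt (real t)"
      by (rule power2_le_imp_le) (use \<open>\<epsilon> > 0\<close> in simp)
    then have "C / sqrt (real t) \<le> \<epsilon>"
      using t1 by (simp add: divide_le_eq)
    with s mono have "E (Suc s) \<epsilon>"
      by blast
    moreover have "real (Suc s) \<le> T"
      using s(1) t(1) by linarith
    ultimately show ?thesis
      unfolding T_def by blast
  qed
  ultimately show ?thesis
    by blast
qed

lemma eps_solution_mono:
  "eps_solution f A b P \<epsilon> x y \<Longrightarrow> \<epsilon> \<le> \<epsilon>' \<Longrightarrow> eps_solution f A b P \<epsilon>' x y"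
  unfolding eps_solution_def by force

section \<open>Gradients, quadratic bounds and variational inequalities\<close>

lemma GDERIV_unique:
  assumes "GDERIV h x :> D" and "GDERIV h x :> D'"
  shows "D = D'"
proof -
  have "(\<lambda>v. v \<bullet> D) = (\<lambda>v. v \<bullet> D')"
    using assms unfolding gderiv_def by (rule has_derivative_unique)
  then show ?thesis
    by (metis inner_commute vector_eq_ldot)
qed

lemma grad_eqI:
  assumes "GDERIV h x :> D"
  shows "grad h x = D"
  unfolding grad_def using assms GDERIV_unique by blast

lemma GDERIV_grad:
  fixes h :: "'a::euclidean_space \<Rightarrow> real"
  assumes "h differentiable (at x)"
  shows "GDERIV h x :> grad h x"
proof -
  obtain h' where h': "(h has_derivative h') (at x)"
    using assms unfolding differentiable_def by blast
  then interpret bounded_linear h'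
    by (rule has_derivative_bounded_linear)
  define D where "D = (\<Sum>i\<in>Basis. h' i *\<^sub>R i)"
  have "h' v = v \<bullet> D" for v
  proof -
    have "h' v = h' (\<Sum>i\<in>Basis. (v \<bullet> i) *\<^sub>R i)"
      by (simp add: euclidean_representation)
    also have "\<dots> = v \<bullet> D"
      by (simp add: D_def sum scaleR inner_sum_right mult.commute)
    finally show ?thesis .
  qed
  then have "GDERIV h x :> D"
    using h' unfolding gderiv_def by presburger
  then show ?thesis
    using grad_eqI by metis
qed

text \<open>On the segment from x to w, subtracting the affine and quadratic parts from h leaves a
  function with nonnegative derivative. The sign of m is free, so the upper bound below follows by
  passing to -h and -M.\<close>

lemma quadratic_lower_bound:
  fixes h :: "'a::real_inner \<Rightarrow> real"
  assumes "convex S"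
    and G: "\<And>x. x \<in> S \<Longrightarrow> GDERIV h x :> g x"
    and mono: "\<And>x x'. x \<in> S \<Longrightarrow> x' \<in> S \<Longrightarrow> (g x - g x') \<bullet> (x - x') \<ge> m * (norm (x - x'))\<^sup>2"
    and x: "x \<in> S" and w: "w \<in> S"
  shows "h w \<ge> h x + g x \<bullet> (w - x) + m / 2 * (norm (w - x))\<^sup>2"
proof -
  define q where "q s = x + s *\<^sub>R (w - x)" for s :: real
  define k where "k s = h (q s) - s * (g x \<bullet> (w - x)) - m / 2 * s\<^sup>2 * (norm (w - x))\<^sup>2" for s
  have qS: "q s \<in> S" if "0 \<le> s" "s \<le> 1" for s
  proof -
    have "q s = (1 - s) *\<^sub>R x + s *\<^sub>R w"
      by (simp add: q_def algebra_simps)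
    then show ?thesis
      using \<open>convex S\<close> x w that by (simp add: convex_alt)
  qed
  have "k 0 \<le> k 1"
  proof (rule DERIV_nonneg_imp_nondecreasing[of 0 1 k])
    fix s :: real
    assume s: "0 \<le> s" "s \<le> 1"
    have dq: "(q has_derivative (\<lambda>v. v *\<^sub>R (w - x))) (at s)"
      unfolding q_def by (auto intro!: derivative_eq_intros)
    have "((\<lambda>s. h (q s)) has_derivative (\<lambda>v. (v *\<^sub>R (w - x)) \<bullet> g (q s))) (at s)"
      using has_derivative_compose[OF dq, of h] G[OF qS[OF s]] unfolding gderiv_def by blast
    then have dh: "((\<lambda>s. h (q s)) has_real_derivative ((w - x) \<bullet> g (q s))) (at s)"
      unfolding has_field_derivative_def by (simp add: mult_commute_abs)
    have D: "(k has_real_derivative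
        ((w - x) \<bullet> g (q s) - g x \<bullet> (w - x) - m * s * (norm (w - x))\<^sup>2)) (at s)"
      unfolding k_def by (rule derivative_eq_intros dh refl | simp)+
    have "(w - x) \<bullet> g (q s) - g x \<bullet> (w - x) - m * s * (norm (w - x))\<^sup>2 \<ge> 0"
    \<comment> \<open>Monotonicity between q s and x yields the wanted inequality multiplied by s,
      which can be cancelled only for positive s.\<close>
    proof (cases "s = 0")
      case True
      then show ?thesis by (simp add: q_def inner_commute)
    next
      case False
      with s have "s > 0" by simp
      have "(g (q s) - g x) \<bullet> (q s - x) \<ge> m * (norm (q s - x))\<^sup>2"
        by (rule mono[OF qS[OF s] x])
      moreover have "q s - x = s *\<^sub>R (w - x)"
        by (simp add: q_def)
      ultimately have "s * ((g (q s) - g x) \<bullet> (w - x)) \<ge> m * (s\<^sup>2 * (norm (w - x))\<^sup>2)"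
        by (simp add: power_mult_distrib)
      then have "s * ((w - x) \<bullet> g (q s) - g x \<bullet> (w - x) - m * s * (norm (w - x))\<^sup>2) \<ge> 0"
        by (simp add: inner_diff_left[of "g (q s)"] inner_commute[of "w - x"] power2_eq_square
            right_diff_distrib mult_ac del: inner_diff_left inner_diff_right)
      with \<open>s > 0\<close> show ?thesis
        by (simp add: zero_le_mult_iff)
    qed
    with D show "\<exists>y. (k has_real_derivative y) (at s) \<and> 0 \<le> y"
      by blast
  qed simp
  then show ?thesis
    by (simp add: k_def q_def)
qed

lemma quadratic_upper_bound:
  fixes h :: "'a::real_inner \<Rightarrow> real"
  assumes "convex S"
    and "\<And>x. x \<in> S \<Longrightarrow> GDERIV h x :> g x"
    and "\<And>x x'. x \<in> S \<Longrightarrow> x' \<in> S \<Longrightarrow> (g x - g x') \<bullet> (x - x') \<le> M * (norm (x - x'))\<^sup>2"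
    and "x \<in> S" and "w \<in> S"
  shows "h w \<le> h x + g x \<bullet> (w - x) + M / 2 * (norm (w - x))\<^sup>2"
  using quadratic_lower_bound[of S "\<lambda>x. - h x" "\<lambda>x. - g x" "- M" x w] assms
  by (force simp: GDERIV_minus inner_diff_left)

lemma minimizer_variational:
  fixes h :: "'a::real_inner \<Rightarrow> real"
  assumes "convex S" and "X \<in> S" and min: "\<And>w. w \<in> S \<Longrightarrow> h X \<le> h w"
    and G: "GDERIV h X :> D" and w: "w \<in> S"
  shows "D \<bullet> (w - X) \<ge> 0"
proof -
  define q where "q s = X + s *\<^sub>R (w - X)" for s :: real
  have dq: "(q has_derivative (\<lambda>v. v *\<^sub>R (w - X))) (at 0)"
    unfolding q_def by (auto intro!: derivative_eq_intros)
  have "((\<lambda>s. h (q s)) has_derivative (\<lambda>v. (v *\<^sub>R (w - X)) \<bullet> D)) (at 0)"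
    by (rule has_derivative_compose[OF dq]) (use G in \<open>simp add: gderiv_def q_def\<close>)
  then have dh: "((\<lambda>s. h (q s)) has_real_derivative ((w - X) \<bullet> D)) (at 0)"
    unfolding has_field_derivative_def by (simp add: mult_commute_abs)
  show ?thesis
  proof (rule ccontr)
    assume "\<not> ?thesis"
    then have "(w - X) \<bullet> D < 0" by (simp add: inner_commute)
    from DERIV_neg_dec_right[OF dh this] obtain e where
      e: "e > 0" "\<And>s. s > 0 \<Longrightarrow> s < e \<Longrightarrow> h (q (0 + s)) < h (q 0)" by blast
    define s where "s = min (e / 2) 1"
    have s: "0 < s" "s < e" "s \<le> 1" using e(1) by (auto simp: s_def)
    have "q s = (1 - s) *\<^sub>R X + s *\<^sub>R w"
      by (simp add: q_def algebra_simps)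
    then have "q s \<in> S"
      using \<open>convex S\<close> \<open>X \<in> S\<close> w s by (simp add: convex_alt)
    with min[of "q s"] e(2)[of s] s show False by (simp add: q_def)
  qed
qed

lemma linear_bounded_right_inverse_on:
  fixes T :: "'a::euclidean_space \<Rightarrow> 'b::euclidean_space"
  assumes "linear T" and "subspace S"
  shows "\<exists>C. C > 0 \<and> (\<forall>d\<in>S. \<exists>d'\<in>S. T d' = T d \<and> norm d' \<le> C * norm (T d))"
proof -
  \<comment> \<open>In finite dimension a linear right inverse with values in S is bounded; its
    bound is the constant C.\<close>
  obtain g where g: "g ` UNIV \<subseteq> S" "linear g" "\<forall>v\<in>T ` S. T (g v) = v"
    using linear_exists_right_inverse_on[OF assms] by blast
  obtain C where C: "C > 0" "\<And>v. norm (g v) \<le> C * norm v"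
    using g(2) linear_bounded_pos by metis
  show ?thesis
    using g(1,3) C by blast
qed

text \<open>The square of the left side is the inner product of v with A applied to w = transpose A
  v, hence at most |v| times the spectral norm times |w|. One factor |w| cancels unless it is
  zero.\<close>

lemma norm_transpose_mult_le:
  fixes A :: "real^'n^'m"
  shows "norm (transpose A *v v) \<le> onorm ((*v) A) * norm v"
proof -
  let ?w = "transpose A *v v"
  have "(norm ?w)\<^sup>2 = v \<bullet> (A *v ?w)"
    by (metis dot_lmul_matrix inner_commute power2_norm_eq_inner transpose_matrix_vector)
  also have "\<dots> \<le> norm v * (onorm ((*v) A) * norm ?w)"
    by (meson mult_left_mono norm_cauchy_schwarz norm_ge_zero onorm order_trans
        matrix_vector_mul_bounded_linear)
  finally have *: "norm ?w * norm ?w \<le> (onorm ((*v) A) * norm v) * norm ?w"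
    by (simp add: power2_eq_square algebra_simps)
  show ?thesis
  proof (cases "?w = 0")
    case True
    then show ?thesis
      by (simp add: onorm_pos_le[OF matrix_vector_mul_bounded_linear])
  next
    case False
    with * show ?thesis
      by (simp add: mult_le_cancel_right)
  qed
qed

lemma inner_transpose_mult:
  fixes A :: "real^'n^'m"
  shows "(transpose A *v v) \<bullet> w = v \<bullet> (A *v w)"
  by (simp add: dot_lmul_matrix)

text \<open>Since 0 lies in S, the affine hull of S is its span, and the relative ball around 0
  becomes a ball of that subspace.\<close>

lemma exists_slater_radius:
  assumes "0 \<in> rel_interior S"
  obtains \<delta> where "\<delta> > 0" and "\<And>v. v \<in> span S \<Longrightarrow> norm v \<le> \<delta> \<Longrightarrow> v \<in> S"
proof -
  obtain e where e: "0 \<in> S" "e > 0" "cball 0 e \<inter> affine hull S \<subseteq> S"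
    using assms mem_rel_interior_cball by blast
  then have "affine hull S = span S"
    by (simp add: affine_hull_span_0 hull_inc)
  with e show thesis by (intro that[of e]) auto
qed

section \<open>The box problem and its proximal augmented Lagrangian\<close>

locale box_problem =
  fixes f :: "real^'n \<Rightarrow> real" and A :: "real^'n^'m" and b :: "real^'m"
    and l u :: "real^'n" and P :: "(real^'n) set" and L \<gamma> \<Gamma> p c :: real
  assumes diff: "\<And>x. f differentiable (at x)"
    and P_eq: "P = {x. \<forall>i. l $ i \<le> x $ i \<and> x $ i \<le> u $ i}"
    and lu: "\<And>i. l $ i < u $ i"
    and slater: "0 \<in> rel_interior ((\<lambda>x. A *v x - b) ` P)"
    and sc: "strict_complementarity f A b l u"
    and L_pos: "L > 0"
    and lip: "\<And>x x'. x \<in> P \<Longrightarrow> x' \<in> P \<Longrightarrow> norm (grad f x - grad f x') \<le> L * norm (x - x')"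
    and mono: "\<And>x x'. x \<in> P \<Longrightarrow> x' \<in> P \<Longrightarrow>
      (grad f x - grad f x') \<bullet> (x - x') \<ge> \<gamma> * (norm (x - x'))\<^sup>2"
    and \<Gamma>_pos: "\<Gamma> > 0" and p_pos: "p > 0" and p_gt: "p > - \<gamma>" and c_pos: "c > 0"
    and c_lt: "c < 1 / (L + p + \<Gamma> * (onorm ((*v) A))\<^sup>2)"
begin

abbreviation \<sigma> :: real where
  "\<sigma> \<equiv> onorm ((*v) A)"

abbreviation K :: "real^'n \<Rightarrow> real^'n \<Rightarrow> real^'m \<Rightarrow> real" where
  "K \<equiv> prox_aug_lagrangian f A b \<Gamma> p"

definition L\<^sub>K :: real where
  "L\<^sub>K = L + p + \<Gamma> * \<sigma>\<^sup>2"

text \<open>The modulus of strong convexity of K in its first argument over the box: the proximal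
  term outweighs a negative \<gamma>, and the penalty term only adds convexity.\<close>

definition m :: real where
  "m = p + \<gamma>"

definition gK :: "real^'n \<Rightarrow> real^'m \<Rightarrow> real^'n \<Rightarrow> real^'n" where
  "gK z y x = grad f x + transpose A *v y + \<Gamma> *\<^sub>R (transpose A *v (A *v x - b)) + p *\<^sub>R (x - z)"

lemma m_pos: "m > 0"
  using p_gt by (simp add: m_def)

lemma \<sigma>_nonneg: "\<sigma> \<ge> 0"
  by (rule onorm_pos_le) simp

lemma norm_A_le: "norm (A *v x) \<le> \<sigma> * norm x"
  by (rule onorm) simp

lemma L\<^sub>K_pos: "L\<^sub>K > 0"
  using L_pos p_pos \<Gamma>_pos by (simp add: L\<^sub>K_def add_pos_nonneg)

lemma c_L\<^sub>K: "1 / c > L\<^sub>K"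
proof -
  have "c < 1 / L\<^sub>K"
    using c_lt by (simp add: L\<^sub>K_def)
  then show ?thesis
    using c_pos L\<^sub>K_pos by (simp add: field_simps)
qed

lemma P_cbox: "P = cbox l u"
  by (auto simp: P_eq mem_box_cart)

lemma convex_P: "convex P" and compact_P: "compact P" and closed_P: "closed P"
  by (simp_all add: P_cbox closed_cbox)

lemma l_in_P: "l \<in> P"
  using lu by (simp add: P_eq less_imp_le)

lemma P_nonempty: "P \<noteq> {}"
  using l_in_P by blast

lemma GDERIV_K: "GDERIV (\<lambda>w. K w z y) x :> gK z y x"
proof -
  have f: "(f has_derivative (\<lambda>h. h \<bullet> grad f x)) (at x)"
    using GDERIV_grad[OF diff] by (simp add: gderiv_def)
  have tr: "h \<bullet> (v v* A) = v \<bullet> (A *v h)" for h and v :: "real^'m"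
    by (metis dot_lmul_matrix inner_commute)
  \<comment> \<open>Squared norms are written as inner products, because the norm itself is not
    differentiable at zero.\<close>
  have "((\<lambda>w. f w + y \<bullet> (A *v w - b) + \<Gamma> / 2 * ((A *v w - b) \<bullet> (A *v w - b))
      + p / 2 * ((w - z) \<bullet> (w - z))) has_derivative (\<lambda>h. h \<bullet> gK z y x)) (at x)"
    by (rule derivative_eq_intros f
        bounded_linear.has_derivative[OF matrix_vector_mul_bounded_linear[of A]] refl)+
      (rule ext, simp add: gK_def inner_add_right inner_diff_right tr algebra_simps,
       simp add: inner_commute[of _ "A *v x"] inner_commute[of _ x] inner_commute[of _ b]
         inner_commute[of _ z])
  then show ?thesis
    unfolding gderiv_def prox_aug_lagrangian_def power2_norm_eq_inner .
qed

lemma gK_diff: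
  "gK z y x - gK z y x' =
    grad f x - grad f x' + \<Gamma> *\<^sub>R (transpose A *v (A *v (x - x'))) + p *\<^sub>R (x - x')"
  by (simp add: gK_def algebra_simps matrix_vector_mult_diff_distrib)

lemma gK_mono:
  assumes "x \<in> P" and "x' \<in> P"
  shows "(gK z y x - gK z y x') \<bullet> (x - x') \<ge> m * (norm (x - x'))\<^sup>2"
proof -
  have "(gK z y x - gK z y x') \<bullet> (x - x') = (grad f x - grad f x') \<bullet> (x - x')
      + \<Gamma> * (norm (A *v (x - x')))\<^sup>2 + p * (norm (x - x'))\<^sup>2"
    by (simp only: gK_diff inner_add_left inner_scaleR_left inner_transpose_mult power2_norm_eq_inner)
  moreover have "\<Gamma> * (norm (A *v (x - x')))\<^sup>2 \<ge> 0"
    using \<Gamma>_pos by simp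
  ultimately show ?thesis
    using mono[OF assms] by (simp add: m_def algebra_simps)
qed

text \<open>The three summands of \<open>gK_diff\<close> contribute L, \<Gamma> \<sigma>^2 and p.
  The bound is stated against a test vector, the form in which both \<open>K_upper\<close> and
  \<open>step_error_bound\<close> use it.\<close>

lemma gK_lipschitz:
  assumes "x \<in> P" and "x' \<in> P"
  shows "(gK z y x - gK z y x') \<bullet> v \<le> L\<^sub>K * norm (x - x') * norm v"
proof -
  have "norm (gK z y x - gK z y x') \<le> norm (grad f x - grad f x')
      + norm (\<Gamma> *\<^sub>R (transpose A *v (A *v (x - x')))) + norm (p *\<^sub>R (x - x'))"
    unfolding gK_diff by (meson add_right_mono norm_triangle_ineq order_trans)
  moreover have "norm (transpose A *v (A *v (x - x'))) \<le> \<sigma> * (\<sigma> * norm (x - x'))"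
    by (meson norm_transpose_mult_le norm_A_le \<sigma>_nonneg mult_left_mono order_trans)
  then have "norm (\<Gamma> *\<^sub>R (transpose A *v (A *v (x - x')))) \<le> \<Gamma> * (\<sigma> * (\<sigma> * norm (x - x')))"
    using \<Gamma>_pos by simp
  ultimately have "norm (gK z y x - gK z y x') \<le> L\<^sub>K * norm (x - x')"
    using lip[OF assms] p_pos
    by (simp add: L\<^sub>K_def power2_eq_square distrib_right mult.assoc)
  then have "norm (gK z y x - gK z y x') * norm v \<le> L\<^sub>K * norm (x - x') * norm v"
    by (rule mult_right_mono) simp
  then show ?thesis
    using norm_cauchy_schwarz order_trans by blast
qed

lemma K_lower:
  "x \<in> P \<Longrightarrow> w \<in> P \<Longrightarrow> K w z y \<ge> K x z y + gK z y x \<bullet> (w - x) + m / 2 * (norm (w - x))\<^sup>2"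
  using quadratic_lower_bound[OF convex_P, of "\<lambda>w. K w z y" "gK z y" m x w] GDERIV_K gK_mono
  by blast

lemma K_upper:
  assumes "x \<in> P" and "w \<in> P"
  shows "K w z y \<le> K x z y + gK z y x \<bullet> (w - x) + L\<^sub>K / 2 * (norm (w - x))\<^sup>2"
proof -
  have "(gK z y x - gK z y x') \<bullet> (x - x') \<le> L\<^sub>K * (norm (x - x'))\<^sup>2"
    if "x \<in> P" "x' \<in> P" for x x'
    using gK_lipschitz[OF that, of z y "x - x'"] by (simp add: power2_eq_square mult.assoc)
  then show ?thesis
    using quadratic_upper_bound[OF convex_P, of "\<lambda>w. K w z y" "gK z y" L\<^sub>K x w] GDERIV_K assms
    by blast
qed

section \<open>The minimizers over the box and over the feasible set\<close>

lemma continuous_on_K: "continuous_on S (\<lambda>w. K w z y)"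
  using GDERIV_K unfolding gderiv_def
  by (meson continuous_at_imp_continuous_on has_derivative_continuous)

text \<open>Existence comes from compactness and uniqueness from \<open>X_growth\<close>, so the
  choice operator makes no arbitrary selection.\<close>

definition X :: "real^'m \<Rightarrow> real^'n \<Rightarrow> real^'n" where
  "X y z = (SOME x. x \<in> P \<and> (\<forall>w\<in>P. K x z y \<le> K w z y))"

lemma X_in_P: "X y z \<in> P" and X_min: "w \<in> P \<Longrightarrow> K (X y z) z y \<le> K w z y"
proof -
  have "\<exists>x. x \<in> P \<and> (\<forall>w\<in>P. K x z y \<le> K w z y)"
    using continuous_attains_inf[OF compact_P P_nonempty continuous_on_K] by blast
  then have "X y z \<in> P \<and> (\<forall>w\<in>P. K (X y z) z y \<le> K w z y)"
    unfolding X_def by (rule someI_ex)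
  then show "X y z \<in> P" and "w \<in> P \<Longrightarrow> K (X y z) z y \<le> K w z y"
    by blast+
qed

lemma X_variational: "w \<in> P \<Longrightarrow> gK z y (X y z) \<bullet> (w - X y z) \<ge> 0"
  using minimizer_variational[OF convex_P X_in_P _ GDERIV_K] X_min by blast

lemma X_growth: "w \<in> P \<Longrightarrow> K w z y \<ge> K (X y z) z y + m / 2 * (norm (w - X y z))\<^sup>2"
  using K_lower[OF X_in_P[of y z], of w z y] X_variational[where w = w and z = z and y = y] by simp

lemma K_change_z:
  "K w z' y - K w z y = p / 2 * ((norm (w - z'))\<^sup>2 - (norm (w - z))\<^sup>2)"
  by (simp add: prox_aug_lagrangian_def algebra_simps)

text \<open>Adding the growth inequalities of the two minimizers, each tested at the other, leaves
  only differences of K between z and z'. These combine to p times the inner product of the two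
  displacements.\<close>

lemma X_lipschitz_z: "norm (X y z - X y z') \<le> p / m * norm (z - z')"
proof -
  let ?x = "X y z" and ?x' = "X y z'"
  have "m * (norm (?x - ?x'))\<^sup>2 \<le> (K ?x' z y - K ?x' z' y) - (K ?x z y - K ?x z' y)"
    using X_growth[OF X_in_P[of y z'], where z = z and y = y] X_growth[OF X_in_P[of y z], where z = z' and y = y]
    by (simp add: norm_minus_commute)
  also have "\<dots> = p * ((?x - ?x') \<bullet> (z - z'))"
    unfolding K_change_z
    by (simp add: power2_norm_eq_inner inner_diff_left inner_diff_right inner_commute algebra_simps)
  also have "\<dots> \<le> p * (norm (?x - ?x') * norm (z - z'))"
    using p_pos by (intro mult_left_mono norm_cauchy_schwarz) simp
  finally have "norm (?x - ?x') * (m * norm (?x - ?x')) \<le> norm (?x - ?x') * (p * norm (z - z'))"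
    by (simp add: power2_eq_square algebra_simps)
  then have "m * norm (?x - ?x') \<le> p * norm (z - z')"
    using p_pos by (cases "norm (?x - ?x') = 0") (auto simp: mult_le_cancel_left)
  then show ?thesis
    using m_pos by (simp add: field_simps)
qed

definition feasible :: "(real^'n) set" where
  "feasible = {x \<in> P. A *v x = b}"

text \<open>On the feasible set the multiplier and penalty terms vanish, so K with multiplier 0 is f
  plus the proximal term there.\<close>

definition Xs :: "real^'n \<Rightarrow> real^'n" where
  "Xs z = (SOME x. x \<in> feasible \<and> (\<forall>w\<in>feasible. K x z 0 \<le> K w z 0))"

lemma K_feasible: "w \<in> feasible \<Longrightarrow> K w z y = K w z 0"
  by (simp add: feasible_def prox_aug_lagrangian_def)

lemma feasible_nonempty: "feasible \<noteq> {}"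
proof -
  have "0 \<in> (\<lambda>x. A *v x - b) ` P"
    using slater rel_interior_subset by blast
  then show ?thesis
    by (force simp: feasible_def)
qed

lemma Xs_feasible: "Xs z \<in> feasible"
  and Xs_min: "w \<in> feasible \<Longrightarrow> K (Xs z) z 0 \<le> K w z 0"
proof -
  have "feasible = P \<inter> (\<lambda>x. A *v x) -` {b}"
    by (auto simp: feasible_def)
  moreover have "closed ((\<lambda>x. A *v x) -` {b})"
    by (intro continuous_closed_vimage closed_singleton linear_continuous_at) simp
  ultimately have "compact feasible"
    using compact_P by (simp add: compact_Int_closed)
  then have "\<exists>x. x \<in> feasible \<and> (\<forall>w\<in>feasible. K x z 0 \<le> K w z 0)"
    using continuous_attains_inf[OF _ feasible_nonempty continuous_on_K] by blast
  then have "Xs z \<in> feasible \<and> (\<forall>w\<in>feasible. K (Xs z) z 0 \<le> K w z 0)"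
    unfolding Xs_def by (rule someI_ex)
  then show "Xs z \<in> feasible" and "w \<in> feasible \<Longrightarrow> K (Xs z) z 0 \<le> K w z 0"
    by blast+
qed

lemma Xs_in_P: "Xs z \<in> P"
  using Xs_feasible by (simp add: feasible_def)

text \<open>Growth at \<open>X y z\<close> is tested at \<open>Xs z\<close>, and the value there is
  at most the value at the feasible w. Both error bounds rest on this: it suffices to exhibit one
  feasible w at which K is little larger than at \<open>X y z\<close>.\<close>

lemma dual_gap_le:
  assumes "w \<in> feasible"
  shows "m / 2 * (norm (X y z - Xs z))\<^sup>2 \<le> K w z y - K (X y z) z y"
  using X_growth[OF Xs_in_P[of z], where z = z and y = y] Xs_min[OF assms, of z] K_feasible[OF assms, of z y]
    K_feasible[OF Xs_feasible[of z], of z y]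
  by (simp add: norm_minus_commute)

section \<open>One projected gradient step\<close>

definition step :: "real^'n \<Rightarrow> real^'n \<Rightarrow> real^'m \<Rightarrow> real^'n" where
  "step x z y = closest_point P (x - c *\<^sub>R gK z y x)"

lemma step_in_P: "step x z y \<in> P"
  unfolding step_def using closed_P P_nonempty by (rule closest_point_in_set)

lemma step_variational:
  assumes "w \<in> P"
  shows "(x - c *\<^sub>R gK z y x - step x z y) \<bullet> (w - step x z y) \<le> 0"
  unfolding step_def using convex_P closed_P assms by (rule closest_point_dot)

text \<open>The projection inequality tested at the old point bounds the slope along the step by
  -1/c times its squared length. As \<open>L\<^sub>K\<close> < 1/c, the curvature term of
  \<open>K_upper\<close> uses up at most half of this.\<close>

lemma step_descent:
  assumes "x \<in> P"
  shows "K (step x z y) z y \<le> K x z y - 1 / (2 * c) * (norm (step x z y - x))\<^sup>2"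
proof -
  let ?e = "step x z y - x"
  have "?e \<bullet> ?e + c * (gK z y x \<bullet> ?e) \<le> 0"
    using step_variational[OF assms, of x z y]
    by (simp add: inner_diff_left inner_diff_right algebra_simps inner_commute)
  then have "gK z y x \<bullet> ?e \<le> - (1 / c) * (norm ?e)\<^sup>2"
    using c_pos by (simp add: power2_norm_eq_inner field_simps)
  moreover have "L\<^sub>K / 2 * (norm ?e)\<^sup>2 \<le> 1 / (2 * c) * (norm ?e)\<^sup>2"
    using c_L\<^sub>K by (intro mult_right_mono) auto
  ultimately show ?thesis
    using K_upper[OF assms step_in_P[of x z y], of z y] by simp
qed

definition \<kappa> :: real where
  "\<kappa> = (L\<^sub>K + 1 / c) / m"

lemma \<kappa>_pos: "\<kappa> > 0"
  using L\<^sub>K_pos c_pos m_pos by (simp add: \<kappa>_def add_pos_pos)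

text \<open>Strong monotonicity is applied between the new point and the minimizer. The variational
  inequality of the minimizer removes one gradient. The other is moved from the new point back to x
  at Lipschitz cost, where the projection inequality bounds it.\<close>

lemma step_error_bound:
  assumes "x \<in> P"
  shows "norm (step x z y - X y z) \<le> \<kappa> * norm (step x z y - x)"
proof -
  let ?s = "step x z y" and ?X = "X y z"
  have "c * (gK z y x \<bullet> (?s - ?X)) \<le> (x - ?s) \<bullet> (?s - ?X)"
    using step_variational[OF X_in_P[of y z], of x z y]
    by (simp add: inner_diff_left inner_diff_right algebra_simps inner_commute)
  also have "\<dots> \<le> norm (?s - x) * norm (?s - ?X)"
    using norm_cauchy_schwarz[of "x - ?s" "?s - ?X"] by (simp add: norm_minus_commute)
  finally have 1: "gK z y x \<bullet> (?s - ?X) \<le> 1 / c * norm (?s - x) * norm (?s - ?X)"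
    using c_pos by (simp add: field_simps)
  have "m * (norm (?s - ?X))\<^sup>2 \<le> gK z y ?s \<bullet> (?s - ?X)"
    using gK_mono[OF step_in_P[of x z y] X_in_P[of y z], of z y] X_variational[OF step_in_P[of x z y], where z = z and y = y]
    by (simp add: inner_diff_left)
  also have "\<dots> \<le> L\<^sub>K * norm (?s - x) * norm (?s - ?X) + 1 / c * norm (?s - x) * norm (?s - ?X)"
    using gK_lipschitz[OF step_in_P[of x z y] assms, of z y "?s - ?X"] 1
    by (simp add: inner_diff_left)
  finally have "norm (?s - ?X) * (m * norm (?s - ?X))
      \<le> norm (?s - ?X) * ((L\<^sub>K + 1 / c) * norm (?s - x))"
    by (simp add: power2_eq_square algebra_simps)
  then have "m * norm (?s - ?X) \<le> (L\<^sub>K + 1 / c) * norm (?s - x)"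
    using L\<^sub>K_pos c_pos by (cases "norm (?s - ?X) = 0") (auto simp: mult_le_cancel_left)
  then show ?thesis
    using m_pos by (simp add: \<kappa>_def field_simps)
qed

section \<open>Error bounds\<close>

lemma bounded_on_P:
  fixes h :: "real^'n \<Rightarrow> 'b::real_normed_vector"
  assumes "continuous_on P h"
  obtains B where "B > 0" and "\<And>x. x \<in> P \<Longrightarrow> norm (h x) \<le> B"
proof -
  have "bounded (h ` P)"
    using compact_P assms by (intro compact_imp_bounded compact_continuous_image)
  then show thesis
    using that unfolding bounded_pos by blast
qed

lemma continuous_on_f: "continuous_on S f"
  using diff by (simp add: continuous_at_imp_continuous_on differentiable_imp_continuous_within)

lemma continuous_on_grad: "continuous_on P (grad f)"
proof -
  have "L-lipschitz_on P (grad f)"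
    using lip L_pos by (intro lipschitz_onI) (auto simp: dist_norm)
  then show ?thesis
    by (rule lipschitz_on_continuous_on)
qed

lemma diameter_bound:
  obtains D where "D > 0" and "\<And>x x'. x \<in> P \<Longrightarrow> x' \<in> P \<Longrightarrow> norm (x - x') \<le> D"
proof -
  obtain D where D: "D > 0" "\<And>x. x \<in> P \<Longrightarrow> norm x \<le> D"
    using bounded_on_P[of "\<lambda>x. x"] by auto
  have "norm (x - x') \<le> 2 * D" if "x \<in> P" "x' \<in> P" for x x'
    using D(2)[OF that(1)] D(2)[OF that(2)] norm_triangle_ineq4[of x x'] by linarith
  then show thesis
    using that[of "2 * D"] D(1) by simp
qed

lemma residual_bound:
  obtains R where "R > 0" and "\<And>x. x \<in> P \<Longrightarrow> norm (A *v x - b) \<le> R"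
proof -
  have "continuous_on P (\<lambda>x. A *v x - b)"
    by (intro continuous_intros linear_continuous_on) simp
  then show thesis
    by (rule bounded_on_P) (rule that)
qed

lemma K_bounded:
  obtains B where "B > 0"
    and "\<And>x y z. norm y \<le> Y \<Longrightarrow> x \<in> P \<Longrightarrow> z \<in> P \<Longrightarrow> \<bar>K x z y\<bar> \<le> B"
proof -
  obtain D where D: "D > 0" "\<And>x x'. x \<in> P \<Longrightarrow> x' \<in> P \<Longrightarrow> norm (x - x') \<le> D"
    using diameter_bound by blast
  obtain R where R: "R > 0" "\<And>x. x \<in> P \<Longrightarrow> norm (A *v x - b) \<le> R"
    using residual_bound by blast
  obtain F where F: "F > 0" "\<And>x. x \<in> P \<Longrightarrow> \<bar>f x\<bar> \<le> F"
    using bounded_on_P[OF continuous_on_f] unfolding real_norm_def by blast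
  \<comment> \<open>The absolute value keeps \<open>B\<close> positive also for negative
    \<open>Y\<close>, when no multiplier qualifies.\<close>
  define B where "B = F + \<bar>Y\<bar> * R + \<Gamma> / 2 * R\<^sup>2 + p / 2 * D\<^sup>2"
  have "\<bar>K x z y\<bar> \<le> B" if "norm y \<le> Y" "x \<in> P" "z \<in> P" for x y z
  proof -
    have "\<bar>y \<bullet> (A *v x - b)\<bar> \<le> norm y * norm (A *v x - b)"
      by (rule Cauchy_Schwarz_ineq2)
    also have "\<dots> \<le> \<bar>Y\<bar> * R"
      using R(2)[OF that(2)] that(1) by (intro mult_mono) auto
    finally have "\<bar>y \<bullet> (A *v x - b)\<bar> \<le> \<bar>Y\<bar> * R" .
    moreover have "\<Gamma> / 2 * (norm (A *v x - b))\<^sup>2 \<le> \<Gamma> / 2 * R\<^sup>2"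
      using R(2)[OF that(2)] \<Gamma>_pos by (intro mult_left_mono power_mono) auto
    moreover have "p / 2 * (norm (x - z))\<^sup>2 \<le> p / 2 * D\<^sup>2"
      using D(2)[OF that(2,3)] p_pos by (intro mult_left_mono power_mono) auto
    moreover have "\<Gamma> / 2 * (norm (A *v x - b))\<^sup>2 \<ge> 0" "p / 2 * (norm (x - z))\<^sup>2 \<ge> 0"
      using \<Gamma>_pos p_pos by simp_all
    ultimately show ?thesis
      using F(2)[OF that(2)] unfolding prox_aug_lagrangian_def B_def by linarith
  qed
  moreover have "B > 0"
    using F(1) R(1) \<Gamma>_pos p_pos unfolding B_def by (simp add: add_pos_nonneg)
  ultimately show thesis
    using that by blast
qed

lemma slater_points:
  obtains \<delta> where "\<delta> > 0"
    and "\<And>v. v \<in> span ((\<lambda>x. A *v x - b) ` P) \<Longrightarrow> norm v \<le> \<delta> \<Longrightarrow> \<exists>w\<in>P. A *v w - b = v"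
proof -
  obtain \<delta> where \<delta>: "\<delta> > 0" "\<And>v. v \<in> span ((\<lambda>x. A *v x - b) ` P) \<Longrightarrow> norm v \<le> \<delta> \<Longrightarrow>
      v \<in> (\<lambda>x. A *v x - b) ` P"
    using exists_slater_radius[OF slater] by blast
  show thesis
    by (rule that[OF \<delta>(1)]) (use \<delta>(2) in fastforce)
qed

text \<open>The residual of a point is cancelled by a convex combination with a point of the box whose
  residual has the opposite direction.\<close>

lemma feasible_distance:
  obtains H where "H > 0"
    and "\<And>x. x \<in> P \<Longrightarrow> \<exists>w\<in>feasible. norm (w - x) \<le> H * norm (A *v x - b)"
proof -
  obtain \<delta> where \<delta>: "\<delta> > 0"
    "\<And>v. v \<in> span ((\<lambda>x. A *v x - b) ` P) \<Longrightarrow> norm v \<le> \<delta> \<Longrightarrow> \<exists>w\<in>P. A *v w - b = v"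
    using slater_points by blast
  obtain D where D: "D > 0" "\<And>x x'. x \<in> P \<Longrightarrow> x' \<in> P \<Longrightarrow> norm (x - x') \<le> D"
    using diameter_bound by blast
  have "\<exists>w\<in>feasible. norm (w - x) \<le> D / \<delta> * norm (A *v x - b)" if x: "x \<in> P" for x
  proof (cases "A *v x = b")
    case True
    with x show ?thesis
      by (intro bexI[of _ x]) (auto simp: feasible_def)
  next
    case False
    define r where "r = A *v x - b"
    have r: "r \<noteq> 0" using False by (simp add: r_def)
    have "r \<in> span ((\<lambda>x. A *v x - b) ` P)"
      using x by (auto simp: r_def intro: span_base)
    then have "(- \<delta> / norm r) *\<^sub>R r \<in> span ((\<lambda>x. A *v x - b) ` P)"
      by (rule span_scale)
    moreover have "norm ((- \<delta> / norm r) *\<^sub>R r) \<le> \<delta>"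
      using r \<delta>(1) by simp
    ultimately obtain w where w: "w \<in> P" "A *v w - b = (- \<delta> / norm r) *\<^sub>R r"
      using \<delta>(2) by blast
    \<comment> \<open>The weight that balances (1 - s) |r| against s \<delta>, so that the opposite
      residuals cancel.\<close>
    define s where "s = norm r / (\<delta> + norm r)"
    have s: "0 \<le> s" "s \<le> 1" "s \<le> norm r / \<delta>"
      proof -
      have pos: "\<delta> + norm r > 0"
        using \<delta>(1) by (simp add: add_pos_nonneg)
      show "0 \<le> s" "s \<le> 1"
        using \<delta>(1) pos by (simp_all add: s_def divide_le_eq)
      show "s \<le> norm r / \<delta>"
        unfolding s_def using \<delta>(1) by (intro divide_left_mono mult_pos_pos pos) auto
    qed
    define x' where "x' = (1 - s) *\<^sub>R x + s *\<^sub>R w"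
    have "x' \<in> P"
      using convex_P x w(1) s unfolding x'_def by (simp add: convex_alt)
    moreover have "A *v x' = b"
    proof -
      have "A *v x' - b = (1 - s) *\<^sub>R r + s *\<^sub>R (A *v w - b)"
        by (simp add: x'_def r_def matrix_vector_right_distrib matrix_vector_mult_scaleR
            algebra_simps)
      also have "\<dots> = ((1 - s) - s * \<delta> / norm r) *\<^sub>R r"
        by (simp add: w(2) scaleR_left_diff_distrib)
      also have "(1 - s) - s * \<delta> / norm r = 0"
      proof -
        have "\<delta> + norm r \<noteq> 0" "norm r \<noteq> 0"
          using \<delta>(1) r by (auto simp: add_pos_nonneg less_imp_neq[symmetric])
        then have "s * \<delta> / norm r = \<delta> / (\<delta> + norm r)" "1 - s = \<delta> / (\<delta> + norm r)"
          by (auto simp: s_def diff_divide_eq_iff)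
        then show ?thesis
          by simp
      qed
      finally show ?thesis by simp
    qed
    moreover have "norm (x' - x) \<le> D / \<delta> * norm r"
    proof -
      have "x' - x = s *\<^sub>R (w - x)"
        by (simp add: x'_def algebra_simps)
      then have "norm (x' - x) = s * norm (w - x)"
        using s by simp
      also have "\<dots> \<le> norm r / \<delta> * D"
        using s D w(1) x \<delta>(1) by (intro mult_mono) auto
      finally show ?thesis by (simp add: mult.commute)
    qed
    ultimately show ?thesis
      by (auto simp: feasible_def r_def)
  qed
  then show thesis
    using that[of "D / \<delta>"] D(1) \<delta>(1) by simp
qed

text \<open>A feasible point lies within a multiple of the residual of \<open>X y z\<close>. For
  bounded multipliers the gradient of K is bounded on the box, so K rises at most linearly in the
  residual on the way there, and \<open>dual_gap_le\<close> turns this into a bound on the squared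
  distance.\<close>

lemma weak_error_bound:
  obtains \<omega> where "\<omega> > 0"
    and "\<And>y z. norm y \<le> Y \<Longrightarrow> z \<in> P \<Longrightarrow>
      (norm (X y z - Xs z))\<^sup>2 \<le> \<omega> * norm (A *v X y z - b)"
proof -
  obtain D where D: "D > 0" "\<And>x x'. x \<in> P \<Longrightarrow> x' \<in> P \<Longrightarrow> norm (x - x') \<le> D"
    using diameter_bound by blast
  obtain R where R: "R > 0" "\<And>x. x \<in> P \<Longrightarrow> norm (A *v x - b) \<le> R"
    using residual_bound by blast
  obtain G where G: "G > 0" "\<And>x. x \<in> P \<Longrightarrow> norm (grad f x) \<le> G"
    using bounded_on_P[OF continuous_on_grad] by blast
  obtain H where H: "H > 0"
    "\<And>x. x \<in> P \<Longrightarrow> \<exists>w\<in>feasible. norm (w - x) \<le> H * norm (A *v x - b)"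
    using feasible_distance by blast
  define N where "N = G + \<sigma> * \<bar>Y\<bar> + \<Gamma> * (\<sigma> * R) + p * D"
  define \<omega> where "\<omega> = 2 / m * ((N + L\<^sub>K / 2 * D) * H)"
  have N: "N > 0"
    using G(1) \<sigma>_nonneg \<Gamma>_pos R(1) p_pos D(1) by (simp add: N_def add_pos_nonneg)
  have "(norm (X y z - Xs z))\<^sup>2 \<le> \<omega> * norm (A *v X y z - b)" if y: "norm y \<le> Y" and z: "z \<in> P" for y z
  proof -
    let ?x = "X y z"
    have x: "?x \<in> P" by (rule X_in_P)
    obtain w where w: "w \<in> feasible" "norm (w - ?x) \<le> H * norm (A *v ?x - b)"
      using H(2)[OF x] by blast
    have wP: "w \<in> P" using w(1) by (simp add: feasible_def)
    have "norm (gK z y ?x) \<le> norm (grad f ?x) + norm (transpose A *v y)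
        + norm (\<Gamma> *\<^sub>R (transpose A *v (A *v ?x - b))) + norm (p *\<^sub>R (?x - z))"
      unfolding gK_def
      by (intro norm_triangle_mono norm_triangle_ineq order_refl)
    also have "norm (transpose A *v y) \<le> \<sigma> * \<bar>Y\<bar>"
      using y \<sigma>_nonneg by (intro order_trans[OF norm_transpose_mult_le] mult_left_mono) auto
    also have "norm (\<Gamma> *\<^sub>R (transpose A *v (A *v ?x - b))) \<le> \<Gamma> * (\<sigma> * R)"
    proof -
      have "norm (transpose A *v (A *v ?x - b)) \<le> \<sigma> * R"
        using R(2)[OF x] \<sigma>_nonneg
        by (intro order_trans[OF norm_transpose_mult_le] mult_left_mono) auto
      then show ?thesis
        using \<Gamma>_pos by (simp add: mult_left_mono)
    qed
    also have "norm (p *\<^sub>R (?x - z)) \<le> p * D"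
      using p_pos D(2)[OF x z] by simp
    finally have g: "norm (gK z y ?x) \<le> N"
      using G(2)[OF x] by (simp add: N_def)
    have "m / 2 * (norm (?x - Xs z))\<^sup>2 \<le> K w z y - K ?x z y"
      by (rule dual_gap_le[OF w(1)])
    also have "\<dots> \<le> gK z y ?x \<bullet> (w - ?x) + L\<^sub>K / 2 * (norm (w - ?x))\<^sup>2"
      using K_upper[OF x wP, of z y] by simp
    also have "gK z y ?x \<bullet> (w - ?x) \<le> N * norm (w - ?x)"
      using g by (intro order_trans[OF norm_cauchy_schwarz] mult_right_mono) auto
    also have "L\<^sub>K / 2 * (norm (w - ?x))\<^sup>2 \<le> L\<^sub>K / 2 * D * norm (w - ?x)"
      using D(2)[OF wP x] L\<^sub>K_pos
      by (simp add: power2_eq_square mult.assoc mult_left_mono mult_right_mono)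
    also have "N * norm (w - ?x) + L\<^sub>K / 2 * D * norm (w - ?x) = (N + L\<^sub>K / 2 * D) * norm (w - ?x)"
      by (simp add: algebra_simps)
    also have "\<dots> \<le> (N + L\<^sub>K / 2 * D) * (H * norm (A *v ?x - b))"
      using w(2) N L\<^sub>K_pos D(1) by (intro mult_left_mono) auto
    finally show ?thesis
      using m_pos by (simp add: \<omega>_def field_simps)
  qed
  moreover have "\<omega> > 0"
    using N L\<^sub>K_pos D(1) H(1) m_pos by (simp add: \<omega>_def add_pos_pos)
  ultimately show thesis
    using that by blast
qed

text \<open>The iteration moves the multiplier only within the span of the residuals, and there a
  residual opposite to \<open>y - y\<^sub>0\<close> makes the dual value decrease linearly.\<close>

lemma dual_coercive:
  obtains U where "\<And>y z. y - y\<^sub>0 \<in> span ((\<lambda>x. A *v x - b) ` P) \<Longrightarrow> z \<in> P \<Longrightarrow>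
    K (X y z) z y \<ge> - B \<Longrightarrow> norm y \<le> U"
proof -
  obtain \<delta> where \<delta>: "\<delta> > 0"
    "\<And>v. v \<in> span ((\<lambda>x. A *v x - b) ` P) \<Longrightarrow> norm v \<le> \<delta> \<Longrightarrow> \<exists>w\<in>P. A *v w - b = v"
    using slater_points by blast
  obtain B' where B': "B' > 0"
    "\<And>x y z. norm y \<le> norm y\<^sub>0 \<Longrightarrow> x \<in> P \<Longrightarrow> z \<in> P \<Longrightarrow> \<bar>K x z y\<bar> \<le> B'"
    using K_bounded by blast
  have "norm y \<le> norm y\<^sub>0 + (B' + \<bar>B\<bar>) / \<delta>" if y: "y - y\<^sub>0 \<in> span ((\<lambda>x. A *v x - b) ` P)"
    and z: "z \<in> P" and B: "K (X y z) z y \<ge> - B" for y z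
  proof (cases "y = y\<^sub>0")
    case True
    then show ?thesis
      using B' \<delta>(1) by simp
  next
    case False
    define v where "v = (- \<delta> / norm (y - y\<^sub>0)) *\<^sub>R (y - y\<^sub>0)"
    have "v \<in> span ((\<lambda>x. A *v x - b) ` P)"
      unfolding v_def using y by (rule span_scale)
    moreover have "norm v \<le> \<delta>"
      using False \<delta>(1) by (simp add: v_def)
    ultimately obtain w where w: "w \<in> P" "A *v w - b = v"
      using \<delta>(2) by blast
    have "(y - y\<^sub>0) \<bullet> v = - \<delta> * norm (y - y\<^sub>0)"
      using False by (simp add: v_def power2_norm_eq_inner[symmetric] power2_eq_square)
    moreover have "K w z y - K w z y\<^sub>0 = (y - y\<^sub>0) \<bullet> v"
      by (simp add: prox_aug_lagrangian_def w(2) inner_diff_left)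
    moreover have "- B \<le> K w z y"
      using B X_min[OF w(1), where y = y and z = z] by linarith
    moreover have "\<bar>K w z y\<^sub>0\<bar> \<le> B'"
      using B'(2) w(1) z by simp
    ultimately have "\<delta> * norm (y - y\<^sub>0) \<le> B' + \<bar>B\<bar>"
      by linarith
    then have "norm (y - y\<^sub>0) \<le> (B' + \<bar>B\<bar>) / \<delta>"
      using \<delta>(1) by (simp add: field_simps)
    then show ?thesis
      using norm_triangle_sub[of y y\<^sub>0] by linarith
  qed
  then show thesis
    using that by blast
qed

text \<open>The box is a product of intervals, so a single coordinate may be moved to either end;
  this isolates one term of the inner product.\<close>

lemma variational_coordinate:
  assumes "x \<in> P" and var: "\<And>w. w \<in> P \<Longrightarrow> G \<bullet> (w - x) \<ge> 0"
  shows "l $ i < x $ i \<Longrightarrow> G $ i \<le> 0" and "x $ i < u $ i \<Longrightarrow> G $ i \<ge> 0"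
proof -
  have move: "G $ i * (s - x $ i) \<ge> 0" if "l $ i \<le> s" "s \<le> u $ i" for s
  proof -
    have "x + axis i (s - x $ i) \<in> P"
      using assms(1) that by (auto simp: P_eq axis_def)
    from var[OF this] show ?thesis
      by (simp add: inner_axis)
  qed
  show "G $ i \<le> 0" if "l $ i < x $ i"
    using move[of "l $ i"] lu[of i] that by (simp add: zero_le_mult_iff less_imp_le)
  show "G $ i \<ge> 0" if "x $ i < u $ i"
    using move[of "u $ i"] lu[of i] that by (simp add: zero_le_mult_iff less_imp_le)
qed

text \<open>The positive and negative parts of the Lagrangian gradient serve as bound multipliers
  and make the point a KKT point. Strict complementarity then excludes a zero component at an active
  bound.\<close>

lemma strict_complementarity_coordinate:
  assumes x: "x \<in> P" "A *v x = b"
    and var: "\<And>w. w \<in> P \<Longrightarrow> (grad f x + transpose A *v y) \<bullet> (w - x) \<ge> 0"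
  shows "x $ i = l $ i \<Longrightarrow> (grad f x + transpose A *v y) $ i > 0"
    and "x $ i = u $ i \<Longrightarrow> (grad f x + transpose A *v y) $ i < 0"
proof -
  define G where "G = grad f x + transpose A *v y"
  define \<mu> where "\<mu> = (\<chi> i. max (G $ i) 0)"
  define \<nu> where "\<nu> = (\<chi> i. max (- G $ i) 0)"
  note coord = variational_coordinate[OF x(1) var, folded G_def]
  have box: "l $ i \<le> x $ i" "x $ i \<le> u $ i" for i
    using x(1) by (simp_all add: P_eq)
  have "G - \<mu> + \<nu> = 0"
    by (simp add: vec_eq_iff \<mu>_def \<nu>_def max_def)
  moreover have "\<mu> $ i * (l $ i - x $ i) = 0" for i
    using coord(1)[of i] box[of i] by (cases "x $ i = l $ i") (auto simp: \<mu>_def)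
  moreover have "\<nu> $ i * (x $ i - u $ i) = 0" for i
    using coord(2)[of i] box[of i] by (cases "x $ i = u $ i") (auto simp: \<nu>_def)
  ultimately have "kkt f A b l u x y \<mu> \<nu>"
    using x(2) box unfolding kkt_def G_def[symmetric] by (simp add: \<mu>_def \<nu>_def)
  with sc have "(\<mu> $ i = 0) \<noteq> (l $ i - x $ i = 0)" "(\<nu> $ i = 0) \<noteq> (x $ i - u $ i = 0)"
    unfolding strict_complementarity_def by blast+
  then show "x $ i = l $ i \<Longrightarrow> (grad f x + transpose A *v y) $ i > 0"
    and "x $ i = u $ i \<Longrightarrow> (grad f x + transpose A *v y) $ i < 0"
    unfolding G_def[symmetric] by (auto simp: \<mu>_def \<nu>_def max_def split: if_splits)
qed

text \<open>There are finitely many index sets, so the constants of the coordinate subspaces have a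
  maximum. A constant independent of I can be fixed before the compactness argument determines the
  face.\<close>

lemma face_right_inverse:
  obtains C where "C > 0"
    and "\<And>I d. \<forall>i\<in>I. d $ i = 0 \<Longrightarrow>
      \<exists>d'. (\<forall>i\<in>I. d' $ i = 0) \<and> A *v d' = A *v d \<and> norm d' \<le> C * norm (A *v d)"
proof -
  define S where "S I = {d :: real^'n. \<forall>i\<in>I. d $ i = 0}" for I
  define good where "good I C \<longleftrightarrow> C > 0 \<and>
    (\<forall>d\<in>S I. \<exists>d'\<in>S I. A *v d' = A *v d \<and> norm d' \<le> C * norm (A *v d))" for I C
  have "\<exists>C. good I C" for I
  proof -
    have "subspace (S I)"
      by (auto simp: S_def subspace_def)
    from linear_bounded_right_inverse_on[OF matrix_vector_mul_linear[of A] this]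
    show ?thesis
      unfolding good_def .
  qed
  then obtain C where C: "\<And>I. good I (C I)"
    by metis
  define C' where "C' = Max (range C)"
  have C': "C I \<le> C'" for I
    unfolding C'_def by (rule Max_ge) auto
  show thesis
  proof (rule that)
    have "C {} > 0"
      using C[of "{}"] by (simp add: good_def)
    with C'[of "{}"] show "C' > 0"
      by linarith
    fix I and d :: "real^'n"
    assume "\<forall>i\<in>I. d $ i = 0"
    then have "d \<in> S I"
      by (simp add: S_def)
    then obtain d' where d': "d' \<in> S I" "A *v d' = A *v d" "norm d' \<le> C I * norm (A *v d)"
      using C[of I] unfolding good_def by blast
    moreover have "C I * norm (A *v d) \<le> C' * norm (A *v d)"
      using C' by (intro mult_right_mono) auto
    ultimately show "\<exists>d'. (\<forall>i\<in>I. d' $ i = 0) \<and> A *v d' = A *v d \<and> norm d' \<le> C' * norm (A *v d)"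
      unfolding S_def by (intro exI[of _ d']) auto
  qed
qed

text \<open>If the active coordinates of \<open>X y z\<close> agree with those of a feasible point, the
  residual can be removed by moving inside the face, where the gradient of \<open>K\<close> vanishes; the
  objective then changes only to second order in the residual.\<close>

lemma error_bound_on_face:
  assumes C: "C > 0" "\<And>I d. \<forall>i\<in>I. d $ i = 0 \<Longrightarrow>
      \<exists>d'. (\<forall>i\<in>I. d' $ i = 0) \<and> A *v d' = A *v d \<and> norm d' \<le> C * norm (A *v d)"
    and x: "A *v x = b"
    and I: "\<And>i. i \<in> I \<Longrightarrow> X y z $ i = x $ i"
    and free: "\<And>i. i \<notin> I \<Longrightarrow> gK z y (X y z) $ i = 0"
    and inside: "\<And>i. i \<notin> I \<Longrightarrow> l $ i + \<eta> \<le> X y z $ i \<and> X y z $ i \<le> u $ i - \<eta>"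
    and small: "C * norm (A *v X y z - b) \<le> \<eta>"
  shows "(norm (X y z - Xs z))\<^sup>2 \<le> L\<^sub>K / m * C\<^sup>2 * (norm (A *v X y z - b))\<^sup>2"
proof -
  let ?x = "X y z"
  have r: "A *v (?x - x) = A *v ?x - b"
    by (simp add: matrix_vector_mult_diff_distrib x)
  \<comment> \<open>The difference of the two points vanishes on I and has the residual as its
    image; d has the same image but a length controlled by it.\<close>
  obtain d where d: "\<And>i. i \<in> I \<Longrightarrow> d $ i = 0" "A *v d = A *v ?x - b"
      "norm d \<le> C * norm (A *v ?x - b)"
    using C(2)[of I "?x - x"] I unfolding r by auto
  define w where "w = ?x - d"
  have "w \<in> P"
    unfolding P_eq
  proof (intro CollectI allI)
    fix i
    show "l $ i \<le> w $ i \<and> w $ i \<le> u $ i"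
    proof (cases "i \<in> I")
      case True
      with d(1) show ?thesis
        using X_in_P[of y z] by (simp add: w_def P_eq)
    next
      case False
      have "\<bar>d $ i\<bar> \<le> \<eta>"
        using component_le_norm_cart[of d i] d(3) small by linarith
      with inside[OF False] show ?thesis
        by (simp add: w_def abs_le_iff)
    qed
  qed
  then have w: "w \<in> feasible"
    using d(2) by (simp add: feasible_def w_def matrix_vector_mult_diff_distrib)
  have "gK z y ?x \<bullet> (w - ?x) = 0"
    unfolding inner_vec_def using d(1) free by (intro sum.neutral) (auto simp: w_def)
  then have "m / 2 * (norm (?x - Xs z))\<^sup>2 \<le> L\<^sub>K / 2 * (norm d)\<^sup>2"
    using dual_gap_le[OF w, of y z] K_upper[OF X_in_P[of y z] \<open>w \<in> P\<close>, of z y]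
    by (simp add: w_def)
  also have "\<dots> \<le> L\<^sub>K / 2 * (C * norm (A *v ?x - b))\<^sup>2"
    using d(3) L\<^sub>K_pos by (intro mult_left_mono power_mono) auto
  finally show ?thesis
    using m_pos by (simp add: field_simps power_mult_distrib)
qed

text \<open>A sequence violating the bound accumulates at a KKT point, and strict complementarity
  there forces the active set of \<open>X y z\<close> to be that of the limit.\<close>

lemma local_error_bound:
  obtains C \<Delta> where "C > 0" and "\<Delta> > 0"
    and "\<And>y z. norm y \<le> Y \<Longrightarrow> z \<in> P \<Longrightarrow> norm (A *v X y z - b) \<le> \<Delta> \<Longrightarrow>
      norm (X y z - z) \<le> \<Delta> \<Longrightarrow>
      (norm (X y z - Xs z))\<^sup>2 \<le> C * (norm (A *v X y z - b))\<^sup>2"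
proof -
  obtain C where C: "C > 0" "\<And>I d. \<forall>i\<in>I. d $ i = 0 \<Longrightarrow>
      \<exists>d'. (\<forall>i\<in>I. d' $ i = 0) \<and> A *v d' = A *v d \<and> norm d' \<le> C * norm (A *v d)"
    using face_right_inverse by blast
  define C' where "C' = L\<^sub>K / m * C\<^sup>2"
  have "\<exists>\<Delta>>0. \<forall>y z. norm y \<le> Y \<longrightarrow> z \<in> P \<longrightarrow> norm (A *v X y z - b) \<le> \<Delta> \<longrightarrow>
      norm (X y z - z) \<le> \<Delta> \<longrightarrow> (norm (X y z - Xs z))\<^sup>2 \<le> C' * (norm (A *v X y z - b))\<^sup>2"
  proof (rule ccontr)
    assume contra: "\<not> ?thesis"
    have "\<exists>y z. norm y \<le> Y \<and> z \<in> P \<and> norm (A *v X y z - b) \<le> 1 / real (Suc n) \<and>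
        norm (X y z - z) \<le> 1 / real (Suc n) \<and>
        \<not> (norm (X y z - Xs z))\<^sup>2 \<le> C' * (norm (A *v X y z - b))\<^sup>2" for n
    proof -
      have "1 / real (Suc n) > 0" by simp
      with contra show ?thesis by blast
    qed
    then obtain yy zz where seq: "\<And>n. norm (yy n) \<le> Y" "\<And>n. zz n \<in> P"
      "\<And>n. norm (A *v X (yy n) (zz n) - b) \<le> 1 / real (Suc n)"
      "\<And>n. norm (X (yy n) (zz n) - zz n) \<le> 1 / real (Suc n)"
      "\<And>n. \<not> (norm (X (yy n) (zz n) - Xs (zz n)))\<^sup>2 \<le> C' * (norm (A *v X (yy n) (zz n) - b))\<^sup>2"
      by metis
    define xx where "xx n = X (yy n) (zz n)" for n
    \<comment> \<open>A limit is extracted only for \<open>xx\<close> and \<open>yy\<close>: the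
      distance from \<open>zz\<close> to \<open>xx\<close> tends to zero.\<close>
    have cpt: "compact (P \<times> (cball 0 Y :: (real^'m) set))"
      using compact_P by (intro compact_Times) auto
    have mem: "\<forall>n. (xx n, yy n) \<in> P \<times> cball 0 Y"
      using seq(1) X_in_P by (simp add: xx_def)
    from cpt[unfolded compact_def, THEN spec, of "\<lambda>n. (xx n, yy n)", THEN mp, OF mem]
    obtain lim \<rho> where lim: "lim \<in> P \<times> cball 0 Y" "strict_mono \<rho>"
        "((\<lambda>n. (xx n, yy n)) \<circ> \<rho>) \<longlonglongrightarrow> lim"
      by blast
    define x y where "x = fst lim" and "y = snd lim"
    have xlim: "(\<lambda>n. xx (\<rho> n)) \<longlonglongrightarrow> x" and ylim: "(\<lambda>n. yy (\<rho> n)) \<longlonglongrightarrow> y"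
      using tendsto_fst[OF lim(3)] tendsto_snd[OF lim(3)] by (simp_all add: x_def y_def o_def)
    have xP: "x \<in> P"
      using lim(1) by (auto simp: x_def)
    have inv: "(\<lambda>n. 1 / real (Suc (\<rho> n))) \<longlonglongrightarrow> 0"
      using LIMSEQ_subseq_LIMSEQ[OF LIMSEQ_Suc[OF lim_1_over_n] lim(2)] by (simp add: o_def)
    have res: "(\<lambda>n. A *v xx (\<rho> n) - b) \<longlonglongrightarrow> 0"
      by (rule Lim_null_comparison[OF _ inv]) (use seq(3) in \<open>simp add: xx_def\<close>)
    have "(\<lambda>n. A *v xx (\<rho> n) - b) \<longlonglongrightarrow> A *v x - b"
      by (intro tendsto_intros bounded_linear.tendsto[OF matrix_vector_mul_bounded_linear] xlim)
    from LIMSEQ_unique[OF this res] have Ax: "A *v x = b"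
      by simp
    have prox: "(\<lambda>n. xx (\<rho> n) - zz (\<rho> n)) \<longlonglongrightarrow> 0"
      by (rule Lim_null_comparison[OF _ inv]) (use seq(4) in \<open>simp add: xx_def\<close>)
    \<comment> \<open>Residual and proximal displacement vanish in the limit, so the gradients of K
      tend to the gradient of the plain Lagrangian and the limit pair is of KKT type.\<close>
    define g where "g = grad f x + transpose A *v y"
    have "(\<lambda>n. grad f (xx (\<rho> n))) \<longlonglongrightarrow> grad f x"
      using continuous_on_tendsto_compose[OF continuous_on_grad xlim xP] X_in_P
      by (simp add: xx_def)
    then have "(\<lambda>n. gK (zz (\<rho> n)) (yy (\<rho> n)) (xx (\<rho> n))) \<longlonglongrightarrow>
        grad f x + transpose A *v y + \<Gamma> *\<^sub>R (transpose A *v 0) + p *\<^sub>R 0"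
      unfolding gK_def
      by (intro tendsto_intros bounded_linear.tendsto[OF matrix_vector_mul_bounded_linear]
          ylim res prox)
    then have glim: "(\<lambda>n. gK (zz (\<rho> n)) (yy (\<rho> n)) (xx (\<rho> n))) \<longlonglongrightarrow> g"
      by (simp add: g_def)
    have var: "g \<bullet> (w - x) \<ge> 0" if "w \<in> P" for w
    proof (rule LIMSEQ_le_const)
      show "(\<lambda>n. gK (zz (\<rho> n)) (yy (\<rho> n)) (xx (\<rho> n)) \<bullet> (w - xx (\<rho> n))) \<longlonglongrightarrow> g \<bullet> (w - x)"
        by (intro tendsto_intros glim xlim)
      show "\<exists>N. \<forall>n\<ge>N. 0 \<le> gK (zz (\<rho> n)) (yy (\<rho> n)) (xx (\<rho> n)) \<bullet> (w - xx (\<rho> n))"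
        using X_variational[OF that] by (simp add: xx_def)
    qed
    have sign: "x $ i = l $ i \<Longrightarrow> g $ i > 0" "x $ i = u $ i \<Longrightarrow> g $ i < 0" for i
      using strict_complementarity_coordinate[OF xP Ax, where y = y and i = i, folded g_def] var
      by blast+
    have coord: "l $ i \<le> xx n $ i" "xx n $ i \<le> u $ i"
      "l $ i < xx n $ i \<Longrightarrow> gK (zz n) (yy n) (xx n) $ i \<le> 0"
      "xx n $ i < u $ i \<Longrightarrow> gK (zz n) (yy n) (xx n) $ i \<ge> 0" for i n
      using X_in_P[of "yy n" "zz n"]
        variational_coordinate[OF X_in_P[of "yy n" "zz n"] X_variational, where i = i]
      by (auto simp: xx_def P_eq)
    define I where "I = {i. x $ i = l $ i \<or> x $ i = u $ i}"
    \<comment> \<open>Half the least distance of a free coordinate of the limit to its bounds,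
      capped at 1; the inserted 1 also keeps the set nonempty when every coordinate is
      active.\<close>
    define \<eta> where "\<eta> = Min (insert 1 ((\<lambda>i. min (x $ i - l $ i) (u $ i - x $ i) / 2) ` (- I)))"
    have "\<eta> > 0"
      unfolding \<eta>_def
      by (subst Min_gr_iff) (use xP in \<open>auto simp: I_def P_eq less_le\<close>)
    have \<eta>: "l $ i + \<eta> < x $ i \<and> x $ i < u $ i - \<eta>" if "i \<notin> I" for i
    proof -
      have "\<eta> \<le> min (x $ i - l $ i) (u $ i - x $ i) / 2"
        unfolding \<eta>_def by (rule Min_le) (use that in auto)
      then have "2 * \<eta> \<le> x $ i - l $ i" "2 * \<eta> \<le> u $ i - x $ i"
        by simp_all
      with \<open>\<eta> > 0\<close> show ?thesis by linarith
    qed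
    have "eventually (\<lambda>n. (i \<in> I \<longrightarrow> xx (\<rho> n) $ i = x $ i) \<and>
        (i \<notin> I \<longrightarrow> l $ i + \<eta> < xx (\<rho> n) $ i \<and> xx (\<rho> n) $ i < u $ i - \<eta>)) sequentially" for i
    proof -
      have xi: "(\<lambda>n. xx (\<rho> n) $ i) \<longlonglongrightarrow> x $ i"
        and gi: "(\<lambda>n. gK (zz (\<rho> n)) (yy (\<rho> n)) (xx (\<rho> n)) $ i) \<longlonglongrightarrow> g $ i"
        by (intro tendsto_vec_nth xlim glim)+
      consider "x $ i = l $ i" | "x $ i = u $ i" | "i \<notin> I"
        by (auto simp: I_def)
      then show ?thesis
      proof cases
        case 1
        then have "i \<in> I" by (simp add: I_def)
        \<comment> \<open>A positive gradient component at a minimizer over the box forces that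
          coordinate onto its lower bound.\<close>
        have "eventually (\<lambda>n. gK (zz (\<rho> n)) (yy (\<rho> n)) (xx (\<rho> n)) $ i > 0) sequentially"
          by (rule order_tendstoD(1)[OF gi sign(1)[OF 1]])
        then show ?thesis
        proof eventually_elim
          case (elim n)
          then show ?case
            using coord(1,3)[where i = i and n = "\<rho> n"] 1 \<open>i \<in> I\<close> by force
        qed
      next
        case 2
        then have "i \<in> I" by (simp add: I_def)
        have "eventually (\<lambda>n. gK (zz (\<rho> n)) (yy (\<rho> n)) (xx (\<rho> n)) $ i < 0) sequentially"
          by (rule order_tendstoD(2)[OF gi sign(2)[OF 2]])
        then show ?thesis
        proof eventually_elim
          case (elim n)
          then show ?case
            using coord(2,4)[where i = i and n = "\<rho> n"] 2 \<open>i \<in> I\<close> by force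
        qed
      next
        case 3
        with \<eta>[OF 3] have "l $ i + \<eta> < x $ i" "x $ i < u $ i - \<eta>"
          by auto
        from order_tendstoD(1)[OF xi this(1)] order_tendstoD(2)[OF xi this(2)]
        show ?thesis
          by eventually_elim (use 3 in auto)
      qed
    qed
    then have 1: "eventually (\<lambda>n. \<forall>i. (i \<in> I \<longrightarrow> xx (\<rho> n) $ i = x $ i) \<and>
        (i \<notin> I \<longrightarrow> l $ i + \<eta> < xx (\<rho> n) $ i \<and> xx (\<rho> n) $ i < u $ i - \<eta>)) sequentially"
      by (rule eventually_all_finite)
    have "(\<lambda>n. C * norm (A *v xx (\<rho> n) - b)) \<longlonglongrightarrow> C * 0"
      by (intro tendsto_intros tendsto_norm_zero res)
    then have 2: "eventually (\<lambda>n. C * norm (A *v xx (\<rho> n) - b) < \<eta>) sequentially"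
      using \<open>\<eta> > 0\<close> by (simp add: order_tendstoD(2))
    obtain n where n: "\<And>i. i \<in> I \<Longrightarrow> xx (\<rho> n) $ i = x $ i"
      "\<And>i. i \<notin> I \<Longrightarrow> l $ i + \<eta> < xx (\<rho> n) $ i \<and> xx (\<rho> n) $ i < u $ i - \<eta>"
      "C * norm (A *v xx (\<rho> n) - b) < \<eta>"
      using eventually_happens[OF eventually_conj[OF 1 2]] by auto
    have "gK (zz (\<rho> n)) (yy (\<rho> n)) (xx (\<rho> n)) $ i = 0" if "i \<notin> I" for i
      using n(2)[OF that] coord(3,4)[where i = i and n = "\<rho> n"] \<open>\<eta> > 0\<close> by force
    then have "(norm (xx (\<rho> n) - Xs (zz (\<rho> n))))\<^sup>2 \<le> C' * (norm (A *v xx (\<rho> n) - b))\<^sup>2"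
      unfolding C'_def xx_def
      by (intro error_bound_on_face[OF C Ax, of I _ _ \<eta>])
        (use n in \<open>auto simp: xx_def less_imp_le\<close>)
    with seq(5)[of "\<rho> n"] show False
      by (simp add: xx_def)
  qed
  moreover have "C' > 0"
    using L\<^sub>K_pos m_pos C(1) by (simp add: C'_def)
  ultimately show thesis
    using that by blast
qed

section \<open>Decrease of the potential\<close>

text \<open>With d and M the dual and the proximal value this is M + (K - d) + (M - d), and both
  gaps are nonnegative. The double weight on d lets its growth outweigh the increase of K at the
  multiplier update, up to an error that the step in x pays for.\<close>

definition \<phi> :: "real^'n \<Rightarrow> real^'m \<Rightarrow> real^'n \<Rightarrow> real" where
  "\<phi> x y z = K x z y - 2 * K (X y z) z y + 2 * K (Xs z) z 0"

lemma prox_descent: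
  assumes "0 \<le> \<beta>" "\<beta> \<le> 1"
  shows "K x (z + \<beta> *\<^sub>R (x - z)) y \<le> K x z y - p * \<beta> / 2 * (norm (x - z))\<^sup>2"
proof -
  have "x - (z + \<beta> *\<^sub>R (x - z)) = (1 - \<beta>) *\<^sub>R (x - z)"
    by (simp add: algebra_simps)
  then have "norm (x - (z + \<beta> *\<^sub>R (x - z))) = (1 - \<beta>) * norm (x - z)"
    using assms by simp
  then have "K x (z + \<beta> *\<^sub>R (x - z)) y - K x z y
      = p / 2 * ((1 - \<beta>)\<^sup>2 * (norm (x - z))\<^sup>2 - (norm (x - z))\<^sup>2)"
    unfolding K_change_z by (simp add: power_mult_distrib)
  also have "\<dots> = - (p * \<beta> / 2 * (norm (x - z))\<^sup>2) - p / 2 * (\<beta> * (1 - \<beta>)) * (norm (x - z))\<^sup>2"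
    by (simp add: power2_eq_square field_simps)
  also have "\<dots> \<le> - (p * \<beta> / 2 * (norm (x - z))\<^sup>2)"
    using assms p_pos by simp
  finally show ?thesis by simp
qed

lemma potential_change:
  fixes x z :: "real^'n" and y :: "real^'m"
  assumes "x \<in> P" "0 \<le> \<beta>" "\<beta> \<le> 1"
    and y': "y' = y + \<alpha> *\<^sub>R (A *v x - b)" and x': "x' = step x z y'"
    and z': "z' = z + \<beta> *\<^sub>R (x' - z)"
  shows "\<phi> x' y' z' \<le> \<phi> x y z
    + \<alpha> * ((norm (A *v x - A *v X y' z))\<^sup>2 - (norm (A *v X y' z - b))\<^sup>2)
    - 1 / (2 * c) * (norm (x' - x))\<^sup>2 - p * \<beta> / 2 * (norm (x' - z))\<^sup>2
    + 2 * p\<^sup>2 / m * \<beta>\<^sup>2 * (norm (x' - z))\<^sup>2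
    + 2 * p * \<beta> * norm (x' - z) * norm (X y' z - Xs z)"
proof -
  let ?X = "X y' z" and ?X' = "X y' z'" and ?q = "norm (x' - z)"
  define r where "r = A *v x - b"
  define R where "R = A *v ?X - b"
  have dz: "norm (z' - z) = \<beta> * ?q"
    using assms(2) by (simp add: z')
  have 1: "K x' z' y' \<le> K x z y + \<alpha> * (r \<bullet> r) - 1 / (2 * c) * (norm (x' - x))\<^sup>2
      - p * \<beta> / 2 * ?q\<^sup>2"
  proof -
    have "K x z y' = K x z y + \<alpha> * (r \<bullet> r)"
      by (simp add: prox_aug_lagrangian_def y' r_def inner_add_left)
    then show ?thesis
      using step_descent[OF assms(1), of z y'] prox_descent[OF assms(2,3), of x' z y']
      unfolding z' x' by linarith
  qed
  \<comment> \<open>Lower bound on the growth of the dual value: \<open>X y' z\<close> competes in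
    the problem of (y, z), and \<open>X y' z'\<close> in that of (y', z).\<close>
  have 2: "K ?X' z' y' - K (X y z) z y \<ge> \<alpha> * (r \<bullet> R)
      + p / 2 * ((norm (?X' - z'))\<^sup>2 - (norm (?X' - z))\<^sup>2)"
  proof -
    have "K ?X z y' = K ?X z y + \<alpha> * (r \<bullet> R)"
      by (simp add: prox_aug_lagrangian_def y' r_def R_def inner_add_left)
    then show ?thesis
      using X_min[OF X_in_P[of y' z], where y = y and z = z]
        X_min[OF X_in_P[of y' z'], where y = y' and z = z] K_change_z[of ?X' z' y' z]
      by linarith
  qed
  have 3: "K (Xs z') z' 0 - K (Xs z) z 0 \<le>
      p / 2 * ((norm (Xs z - z'))\<^sup>2 - (norm (Xs z - z))\<^sup>2)"
    using Xs_min[OF Xs_feasible[of z], of z'] K_change_z[of "Xs z" z' 0 z] by linarith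
  \<comment> \<open>The proximal terms of the primal and the dual value combine to a bilinear
    expression, small when the two minimizers are close.\<close>
  have 4: "(norm (Xs z - z'))\<^sup>2 - (norm (Xs z - z))\<^sup>2 - ((norm (?X' - z'))\<^sup>2 - (norm (?X' - z))\<^sup>2)
      = 2 * ((z' - z) \<bullet> (?X' - Xs z))"
    by (simp add: power2_norm_eq_inner inner_diff_left inner_diff_right inner_commute algebra_simps)
  have 5: "(z' - z) \<bullet> (?X' - Xs z) \<le> \<beta> * ?q * (p / m * (\<beta> * ?q) + norm (?X - Xs z))"
  proof -
    have "norm (?X' - Xs z) \<le> norm (?X' - ?X) + norm (?X - Xs z)"
      using norm_triangle_ineq[of "?X' - ?X" "?X - Xs z"] by simp
    also have "norm (?X' - ?X) \<le> p / m * (\<beta> * ?q)"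
      using X_lipschitz_z[of y' z' z] by (simp add: dz)
    finally have "norm (z' - z) * norm (?X' - Xs z)
        \<le> \<beta> * ?q * (p / m * (\<beta> * ?q) + norm (?X - Xs z))"
      unfolding dz using assms(2) by (intro mult_left_mono) auto
    then show ?thesis
      using norm_cauchy_schwarz order_trans by blast
  qed
  have "\<phi> x' y' z' - \<phi> x y z \<le> \<alpha> * (r \<bullet> r) - 2 * \<alpha> * (r \<bullet> R) - 1 / (2 * c) * (norm (x' - x))\<^sup>2
      - p * \<beta> / 2 * ?q\<^sup>2 + 2 * p * ((z' - z) \<bullet> (?X' - Xs z))"
    using 1 2 3 arg_cong[OF 4, of "\<lambda>v. p * v"] unfolding \<phi>_def by (simp add: algebra_simps)
  also have "2 * p * ((z' - z) \<bullet> (?X' - Xs z))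
      \<le> 2 * p * (\<beta> * ?q * (p / m * (\<beta> * ?q) + norm (?X - Xs z)))"
    using 5 p_pos by (intro mult_left_mono) auto
  also have "\<dots> = 2 * p\<^sup>2 / m * \<beta>\<^sup>2 * ?q\<^sup>2 + 2 * p * \<beta> * ?q * norm (?X - Xs z)"
    by (simp add: power2_eq_square algebra_simps)
  \<comment> \<open>Completing the square: |r|^2 - 2 r \<bullet> R = |r - R|^2 - |R|^2.\<close>
  also have "\<alpha> * (r \<bullet> r) - 2 * \<alpha> * (r \<bullet> R)
      = \<alpha> * ((norm (A *v x - A *v ?X))\<^sup>2 - (norm (A *v ?X - b))\<^sup>2)"
  proof -
    have diff: "A *v x - A *v ?X = r - R"
      by (simp add: r_def R_def)
    show ?thesis
      unfolding R_def[symmetric] diff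
      by (simp add: power2_norm_eq_inner inner_diff_left inner_diff_right inner_commute
          algebra_simps)
  qed
  finally show ?thesis
    by simp
qed

text \<open>The positive terms of \<open>potential_change\<close> are absorbed. The distance from x
  to \<open>X y' z\<close> is at most (1 + \<kappa>) times the step in x, so a small \<alpha>
  handles the first; a small \<beta> handles the quadratic one; Young's inequality splits the mixed
  one.\<close>

lemma potential_decrease:
  fixes x z :: "real^'n" and y :: "real^'m"
  assumes "x \<in> P" "0 \<le> \<beta>" "\<beta> \<le> 1"
    and y': "y' = y + \<alpha> *\<^sub>R (A *v x - b)" and x': "x' = step x z y'"
    and z': "z' = z + \<beta> *\<^sub>R (x' - z)"
    and \<alpha>: "0 < \<alpha>" "4 * c * \<alpha> * (\<sigma> * (1 + \<kappa>))\<^sup>2 \<le> 1" and \<beta>: "16 * p * \<beta> \<le> m"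
  shows "\<phi> x' y' z' \<le> \<phi> x y z - 1 / (4 * c) * (norm (x' - x))\<^sup>2
    - \<alpha> * (norm (A *v X y' z - b))\<^sup>2 - p * \<beta> / 4 * (norm (x' - z))\<^sup>2
    + 8 * p * \<beta> * (norm (X y' z - Xs z))\<^sup>2"
proof -
  let ?e = "norm (x' - x)" and ?q = "norm (x' - z)" and ?E = "norm (X y' z - Xs z)"
  have "norm (x - X y' z) \<le> norm (x - x') + norm (x' - X y' z)"
    using norm_triangle_ineq[of "x - x'" "x' - X y' z"] by simp
  then have "norm (x - X y' z) \<le> (1 + \<kappa>) * ?e"
    using step_error_bound[OF assms(1), of z y'] unfolding x'
    by (simp add: norm_minus_commute algebra_simps)
  then have "norm (A *v x - A *v X y' z) \<le> \<sigma> * ((1 + \<kappa>) * ?e)"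
    unfolding matrix_vector_mult_diff_distrib[symmetric]
    by (intro order_trans[OF norm_A_le] mult_left_mono \<sigma>_nonneg)
  then have "\<alpha> * (norm (A *v x - A *v X y' z))\<^sup>2 \<le> \<alpha> * (\<sigma> * ((1 + \<kappa>) * ?e))\<^sup>2"
    using \<alpha>(1) by (intro mult_left_mono power_mono) auto
  also have "\<dots> = (4 * c * \<alpha> * (\<sigma> * (1 + \<kappa>))\<^sup>2) * (1 / (4 * c) * ?e\<^sup>2)"
    using c_pos by (simp add: power_mult_distrib)
  also have "\<dots> \<le> 1 * (1 / (4 * c) * ?e\<^sup>2)"
    using \<alpha>(2) c_pos by (intro mult_right_mono) auto
  finally have 1: "\<alpha> * (norm (A *v x - A *v X y' z))\<^sup>2 \<le> 1 / (4 * c) * ?e\<^sup>2"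
    by simp
  have 2: "2 * p\<^sup>2 / m * \<beta>\<^sup>2 * ?q\<^sup>2 \<le> p * \<beta> / 8 * ?q\<^sup>2"
  proof (rule mult_right_mono)
    have "2 * p\<^sup>2 / m * \<beta>\<^sup>2 = p * \<beta> / 8 * ((16 * p * \<beta>) / m)"
      by (simp add: power2_eq_square)
    also have "\<dots> \<le> p * \<beta> / 8 * 1"
      using \<beta> m_pos p_pos assms(2) by (intro mult_left_mono) (auto simp: divide_le_eq)
    finally show "2 * p\<^sup>2 / m * \<beta>\<^sup>2 \<le> p * \<beta> / 8" by simp
  qed simp
  \<comment> \<open>The weight p \<beta> / 8 on the squared displacement is what can be spared from
    the decrease in z; it fixes the factor 8 of the error term.\<close>
  have 3: "2 * p * \<beta> * ?q * ?E \<le> p * \<beta> / 8 * ?q\<^sup>2 + 8 * p * \<beta> * ?E\<^sup>2"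
  proof -
    have "0 \<le> p * \<beta> / 8 * (?q - 8 * ?E)\<^sup>2"
      using p_pos assms(2) by simp
    also have "\<dots> = p * \<beta> / 8 * ?q\<^sup>2 + 8 * p * \<beta> * ?E\<^sup>2 - 2 * p * \<beta> * ?q * ?E"
      by (simp add: power2_eq_square algebra_simps)
    finally show ?thesis by simp
  qed
  \<comment> \<open>Half of the decrease in x pays for fact 1; a quarter of the decrease in z pays
    for each of facts 2 and 3.\<close>
  have c2: "1 / (2 * c) * ?e\<^sup>2 = 1 / (4 * c) * ?e\<^sup>2 + 1 / (4 * c) * ?e\<^sup>2"
    by (simp add: field_simps)
  have q2: "p * \<beta> / 2 * ?q\<^sup>2 = p * \<beta> / 4 * ?q\<^sup>2 + p * \<beta> / 8 * ?q\<^sup>2 + p * \<beta> / 8 * ?q\<^sup>2"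
    by (simp add: field_simps)
  show ?thesis
    using potential_change[OF assms(1-3) y' x' z'] 1 2 3 c2 q2
    by (simp only: right_diff_distrib)
qed

text \<open>Away from the region of the local error bound, the weak one suffices: either
  the residual or one of the two step lengths is bounded below, and the error term is absorbed
  because it is of order \<open>\<beta>\<close>, or of order \<open>\<beta>\<^sup>2\<close> after Young's inequality.\<close>

lemma potential_sufficient_decrease:
  fixes Y \<alpha> :: real
  assumes \<alpha>: "0 < \<alpha>" "4 * c * \<alpha> * (\<sigma> * (1 + \<kappa>))\<^sup>2 \<le> 1"
  shows "\<exists>\<beta>\<^sub>0>0. \<forall>\<beta> x y z x' y' z'. 0 < \<beta> \<longrightarrow> \<beta> < \<beta>\<^sub>0 \<longrightarrow> \<beta> \<le> 1 \<longrightarrow> x \<in> P \<longrightarrow> z \<in> P \<longrightarrow>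
      y' = y + \<alpha> *\<^sub>R (A *v x - b) \<longrightarrow> x' = step x z y' \<longrightarrow> z' = z + \<beta> *\<^sub>R (x' - z) \<longrightarrow>
      norm y' \<le> Y \<longrightarrow>
      \<phi> x' y' z' \<le> \<phi> x y z - 1 / (8 * c) * (norm (x' - x))\<^sup>2
        - \<alpha> / 2 * (norm (A *v X y' z - b))\<^sup>2 - p * \<beta> / 8 * (norm (x' - z))\<^sup>2"
proof -
  obtain C \<Delta> where C: "C > 0" and \<Delta>: "\<Delta> > 0"
    and local_eb: "\<And>y z. norm y \<le> Y \<Longrightarrow> z \<in> P \<Longrightarrow> norm (A *v X y z - b) \<le> \<Delta> \<Longrightarrow>
      norm (X y z - z) \<le> \<Delta> \<Longrightarrow>
      (norm (X y z - Xs z))\<^sup>2 \<le> C * (norm (A *v X y z - b))\<^sup>2"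
    using local_error_bound by blast
  obtain \<omega> where \<omega>: "\<omega> > 0"
    and weak_eb: "\<And>y z. norm y \<le> Y \<Longrightarrow> z \<in> P \<Longrightarrow>
      (norm (X y z - Xs z))\<^sup>2 \<le> \<omega> * norm (A *v X y z - b)"
    using weak_error_bound by blast
  \<comment> \<open>Chosen so that the remainder of Young's inequality in the second case below is S
    \<beta>^2 \<Delta>^2 / 2.\<close>
  define S where "S = (8 * p * \<omega>)\<^sup>2 / (\<alpha> * \<Delta>\<^sup>2)"
  have S: "S > 0"
    using p_pos \<omega> \<alpha>(1) \<Delta> by (simp add: S_def)
  \<comment> \<open>In order: the premise of \<open>potential_decrease\<close>, the local case, the
    case of a large residual, and for a large proximal displacement the parts in z and in x.\<close>
  define \<beta>\<^sub>0 where "\<beta>\<^sub>0 = Min {m / (16 * p), \<alpha> / (16 * p * C), \<alpha> * \<Delta> / (16 * p * \<omega>), p / (8 * S),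
    1 / (8 * c * S * \<kappa>\<^sup>2)}"
  have "\<beta>\<^sub>0 > 0"
    using m_pos p_pos \<alpha>(1) C \<Delta> \<omega> S c_pos \<kappa>_pos by (simp add: \<beta>\<^sub>0_def)
  moreover have "\<phi> x' y' z' \<le> \<phi> x y z - 1 / (8 * c) * (norm (x' - x))\<^sup>2
        - \<alpha> / 2 * (norm (A *v X y' z - b))\<^sup>2 - p * \<beta> / 8 * (norm (x' - z))\<^sup>2"
    if \<beta>: "0 < \<beta>" "\<beta> < \<beta>\<^sub>0" "\<beta> \<le> 1" and P: "x \<in> P" "z \<in> P"
      and upd: "y' = y + \<alpha> *\<^sub>R (A *v x - b)" "x' = step x z y'" "z' = z + \<beta> *\<^sub>R (x' - z)"
      and Y: "norm y' \<le> Y" for \<beta> x y z x' y' z'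
  proof -
    let ?e = "norm (x' - x)" and ?q = "norm (x' - z)" and ?E = "norm (X y' z - Xs z)"
      and ?r = "norm (A *v X y' z - b)"
    have "\<beta> < m / (16 * p)" "\<beta> < \<alpha> / (16 * p * C)" "\<beta> < \<alpha> * \<Delta> / (16 * p * \<omega>)"
      "\<beta> < p / (8 * S)" "\<beta> < 1 / (8 * c * S * \<kappa>\<^sup>2)"
      using \<beta>(2) by (simp_all add: \<beta>\<^sub>0_def)
    then have "\<beta> * (16 * p) < m" "\<beta> * (16 * p * C) < \<alpha>" "\<beta> * (16 * p * \<omega>) < \<alpha> * \<Delta>"
      "\<beta> * (8 * S) < p" and "\<beta> * (8 * c * S * \<kappa>\<^sup>2) < 1"
      using p_pos C \<omega> S c_pos \<kappa>_pos by (simp_all add: pos_less_divide_eq)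
    moreover from this(5) have "8 * c * (S * \<beta> * \<kappa>\<^sup>2) \<le> 1"
      by (simp add: mult_ac)
    then have "S * \<beta> * \<kappa>\<^sup>2 \<le> 1 / (8 * c)"
      using c_pos by (simp add: pos_le_divide_eq mult_ac)
    ultimately have \<beta>1: "16 * p * \<beta> \<le> m" and \<beta>2: "8 * p * \<beta> * C \<le> \<alpha> / 2"
      and \<beta>3: "8 * p * \<beta> * \<omega> \<le> \<alpha> / 2 * \<Delta>" and \<beta>4: "S * \<beta> \<le> p / 8"
      and \<beta>5: "S * \<beta> * \<kappa>\<^sup>2 \<le> 1 / (8 * c)"
      by (simp_all add: mult_ac)
    have "8 * p * \<beta> * ?E\<^sup>2 \<le> \<alpha> / 2 * ?r\<^sup>2 + 1 / (8 * c) * ?e\<^sup>2 + p * \<beta> / 8 * ?q\<^sup>2"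
    proof -
      consider "?r > \<Delta>" | "norm (X y' z - z) > \<Delta>" | "?r \<le> \<Delta>" "norm (X y' z - z) \<le> \<Delta>"
        by linarith
      then show ?thesis
      proof cases
        case 1
        have "8 * p * \<beta> * ?E\<^sup>2 \<le> 8 * p * \<beta> * (\<omega> * ?r)"
          using weak_eb[OF Y P(2)] p_pos \<beta>(1) by (intro mult_left_mono) auto
        also have "\<dots> = (8 * p * \<beta> * \<omega>) * ?r"
          by simp
        also have "\<dots> \<le> (\<alpha> / 2 * \<Delta>) * ?r"
          using \<beta>3 by (intro mult_right_mono) auto
        also have "\<dots> = \<alpha> / 2 * (\<Delta> * ?r)"
          by simp
        also have "\<dots> \<le> \<alpha> / 2 * ?r\<^sup>2"
          unfolding power2_eq_square using 1 \<alpha>(1) by (intro mult_left_mono mult_right_mono) auto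
        finally show ?thesis
          using c_pos p_pos \<beta>(1) by (simp add: add_increasing2)
      next
        case 2
        have "8 * p * \<beta> * ?E\<^sup>2 \<le> 8 * p * \<beta> * (\<omega> * ?r)"
          using weak_eb[OF Y P(2)] p_pos \<beta>(1) by (intro mult_left_mono) auto
        also have "\<dots> \<le> \<alpha> / 2 * ?r\<^sup>2 + (8 * p * \<omega> * \<beta>)\<^sup>2 / (2 * \<alpha>)"
        proof -
          have "0 \<le> \<alpha> / 2 * (?r - 8 * p * \<omega> * \<beta> / \<alpha>)\<^sup>2"
            using \<alpha>(1) by simp
          also have "\<dots> = \<alpha> / 2 * ?r\<^sup>2 + (8 * p * \<omega> * \<beta>)\<^sup>2 / (2 * \<alpha>) - 8 * p * \<beta> * (\<omega> * ?r)"
            using \<alpha>(1) by (simp add: power2_eq_square field_simps)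
          finally show ?thesis by simp
        qed
        also have "(8 * p * \<omega> * \<beta>)\<^sup>2 / (2 * \<alpha>) = S * \<beta>\<^sup>2 / 2 * \<Delta>\<^sup>2"
          using \<Delta> by (simp add: S_def power_mult_distrib)
        \<comment> \<open>In this case \<Delta> is below the distance from \<open>X y' z\<close> to
          z, which the two step lengths bound; the constant remainder thus becomes a multiple of
          terms that decrease.\<close>
        also have "S * \<beta>\<^sup>2 / 2 * \<Delta>\<^sup>2 \<le> S * \<beta>\<^sup>2 / 2 * (2 * \<kappa>\<^sup>2 * ?e\<^sup>2 + 2 * ?q\<^sup>2)"
        proof -
          have "norm (X y' z - z) \<le> norm (X y' z - x') + ?q"
            using norm_triangle_ineq[of "X y' z - x'" "x' - z"] by simp
          also have "norm (X y' z - x') \<le> \<kappa> * ?e"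
            using step_error_bound[OF P(1), of z y'] upd(2) by (simp add: norm_minus_commute)
          finally have "\<Delta>\<^sup>2 \<le> (\<kappa> * ?e + ?q)\<^sup>2"
            using 2 \<Delta> by (intro power_mono) auto
          also have "\<dots> \<le> 2 * \<kappa>\<^sup>2 * ?e\<^sup>2 + 2 * ?q\<^sup>2"
            using zero_le_power2[of "\<kappa> * ?e - ?q"]
            by (simp add: power2_eq_square algebra_simps)
          finally show ?thesis
            using S by (intro mult_left_mono) auto
        qed
        also have "\<dots> = (S * \<beta> * \<kappa>\<^sup>2) * \<beta> * ?e\<^sup>2 + (S * \<beta>) * \<beta> * ?q\<^sup>2"
          by (simp add: power2_eq_square algebra_simps)
        also have "(S * \<beta> * \<kappa>\<^sup>2) * \<beta> * ?e\<^sup>2 \<le> 1 / (8 * c) * 1 * ?e\<^sup>2"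
          using \<beta>5 \<beta>(1,3) S c_pos by (intro mult_right_mono mult_mono) auto
        also have "(S * \<beta>) * \<beta> * ?q\<^sup>2 \<le> p / 8 * \<beta> * ?q\<^sup>2"
          using \<beta>4 \<beta>(1) by (intro mult_right_mono) auto
        finally show ?thesis by simp
      next
        case 3
        have "8 * p * \<beta> * ?E\<^sup>2 \<le> 8 * p * \<beta> * (C * ?r\<^sup>2)"
          using local_eb[OF Y P(2) 3] p_pos \<beta>(1) by (intro mult_left_mono) auto
        also have "\<dots> = (8 * p * \<beta> * C) * ?r\<^sup>2"
          by simp
        also have "\<dots> \<le> \<alpha> / 2 * ?r\<^sup>2"
          using \<beta>2 by (intro mult_right_mono) auto
        finally show ?thesis
          using c_pos p_pos \<beta>(1) by (simp add: add_increasing2)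
      qed
    qed
    moreover have "1 / (4 * c) * ?e\<^sup>2 = 1 / (8 * c) * ?e\<^sup>2 + 1 / (8 * c) * ?e\<^sup>2"
      "p * \<beta> / 4 * ?q\<^sup>2 = p * \<beta> / 8 * ?q\<^sup>2 + p * \<beta> / 8 * ?q\<^sup>2"
      "\<alpha> * ?r\<^sup>2 = \<alpha> / 2 * ?r\<^sup>2 + \<alpha> / 2 * ?r\<^sup>2"
      by (simp_all add: field_simps)
    ultimately show ?thesis
      using potential_decrease[OF P(1) less_imp_le[OF \<beta>(1)] \<beta>(3) upd \<alpha> \<beta>1] by linarith
  qed
  ultimately show ?thesis
    by (intro exI[of _ \<beta>\<^sub>0] conjI allI impI)
qed

section \<open>Approximate solutions from short steps\<close>

lemma indicator_subgradient:
  assumes "x \<in> P" and "\<And>w. w \<in> P \<Longrightarrow> g \<bullet> (w - x) \<le> 0"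
  shows "g \<in> subdifferential (convex_indicator P) x"
  using assms by (auto simp: subdifferential_def convex_indicator_def)

text \<open>The projection inequality makes (1/c) (x - c gK - x') a normal vector at the new point
  x', hence a subgradient of the indicator. Adding it to the Lagrangian gradient at x' cancels the
  multiplier term and leaves differences bounded by the step lengths and the residual.\<close>

lemma eps_solution_step:
  assumes "x \<in> P" "z \<in> P"
    and e: "norm (step x z y - x) \<le> \<rho>" and r: "norm (A *v X y z - b) \<le> \<rho>"
    and q: "norm (step x z y - z) \<le> \<rho>"
  shows "eps_solution f A b P
    ((1 + \<sigma> * \<kappa> + L + 1 / c + \<Gamma> * (\<sigma> * (1 + \<sigma> * (1 + \<kappa>))) + 2 * p) * \<rho>) (step x z y) y"
proof -
  define x' where "x' = step x z y"
  note e = e[folded x'_def] and q = q[folded x'_def]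
  have \<rho>: "\<rho> \<ge> 0"
    using r norm_ge_zero order_trans by blast
  have x'P: "x' \<in> P"
    unfolding x'_def by (rule step_in_P)
  have err: "norm (x' - X y z) \<le> \<kappa> * \<rho>"
    unfolding x'_def using e[unfolded x'_def] \<kappa>_pos
    by (intro order_trans[OF step_error_bound[OF assms(1)]] mult_left_mono) auto
  have err': "norm (x - X y z) \<le> (1 + \<kappa>) * \<rho>"
    using norm_triangle_ineq[of "x - x'" "x' - X y z"] err e
    by (simp add: norm_minus_commute distrib_right)
  have res: "norm (A *v w - b) \<le> \<rho> + \<sigma> * B" if "norm (w - X y z) \<le> B" for w B
  proof -
    have "A *v w - b = A *v (w - X y z) + (A *v X y z - b)"
      by (simp add: matrix_vector_mult_diff_distrib)
    then have "norm (A *v w - b) \<le> norm (A *v (w - X y z)) + norm (A *v X y z - b)"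
      by (metis norm_triangle_ineq)
    also have "norm (A *v (w - X y z)) \<le> \<sigma> * B"
      by (intro order_trans[OF norm_A_le] mult_left_mono \<sigma>_nonneg that)
    finally show ?thesis
      using r by simp
  qed
  let ?N = "1 + \<sigma> * \<kappa> + L + 1 / c + \<Gamma> * (\<sigma> * (1 + \<sigma> * (1 + \<kappa>))) + 2 * p"
  have pos: "\<sigma> * \<kappa> * \<rho> \<ge> 0" "L * \<rho> \<ge> 0" "1 / c * \<rho> \<ge> 0"
      "\<Gamma> * (\<sigma> * (1 + \<sigma> * (1 + \<kappa>))) * \<rho> \<ge> 0" "2 * p * \<rho> \<ge> 0"
    using \<rho> \<sigma>_nonneg \<kappa>_pos L_pos c_pos \<Gamma>_pos p_pos by simp_all
  have N: "?N * \<rho> = \<rho> + \<sigma> * \<kappa> * \<rho> + L * \<rho> + 1 / c * \<rho>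
      + \<Gamma> * (\<sigma> * (1 + \<sigma> * (1 + \<kappa>))) * \<rho> + 2 * p * \<rho>"
    by (simp only: distrib_right mult_1_left)
  have "norm (A *v x' - b) \<le> ?N * \<rho>"
    using res[OF err] pos N mult.assoc[of \<sigma> \<kappa> \<rho>] by linarith
  moreover define g where "g = (1 / c) *\<^sub>R (x - c *\<^sub>R gK z y x - x')"
  have "g \<in> subdifferential (convex_indicator P) x'"
  proof (rule indicator_subgradient[OF x'P])
    fix w assume "w \<in> P"
    from step_variational[OF this, of x z y]
    show "g \<bullet> (w - x') \<le> 0"
      using c_pos by (simp add: g_def x'_def divide_le_0_iff)
  qed
  moreover have "norm (grad f x' + transpose A *v y + g) \<le> ?N * \<rho>"
  proof -
    have "grad f x' + transpose A *v y + g = (grad f x' - grad f x) + (1 / c) *\<^sub>R (x - x')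
        - \<Gamma> *\<^sub>R (transpose A *v (A *v x - b)) - p *\<^sub>R (x - z)"
      using c_pos by (simp add: g_def gK_def algebra_simps)
    also have "norm \<dots> \<le> norm (grad f x' - grad f x) + norm ((1 / c) *\<^sub>R (x - x'))
        + norm (\<Gamma> *\<^sub>R (transpose A *v (A *v x - b))) + norm (p *\<^sub>R (x - z))"
      by (intro order_trans[OF norm_triangle_ineq4] add_right_mono norm_triangle_ineq)
    also have "norm (grad f x' - grad f x) \<le> L * \<rho>"
      using e L_pos by (intro order_trans[OF lip[OF x'P assms(1)]] mult_left_mono) auto
    also have "norm ((1 / c) *\<^sub>R (x - x')) \<le> 1 / c * \<rho>"
      using e c_pos by (simp add: norm_minus_commute divide_right_mono)
    also have "norm (\<Gamma> *\<^sub>R (transpose A *v (A *v x - b))) \<le> \<Gamma> * (\<sigma> * (1 + \<sigma> * (1 + \<kappa>))) * \<rho>"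
    proof -
      have "norm (transpose A *v (A *v x - b)) \<le> \<sigma> * (\<rho> + \<sigma> * ((1 + \<kappa>) * \<rho>))"
        by (intro order_trans[OF norm_transpose_mult_le] mult_left_mono \<sigma>_nonneg res err')
      also have "\<dots> = \<sigma> * (1 + \<sigma> * (1 + \<kappa>)) * \<rho>"
        by (simp add: algebra_simps)
      finally show ?thesis
        using \<Gamma>_pos by (simp add: mult.assoc)
    qed
    also have "norm (p *\<^sub>R (x - z)) \<le> 2 * p * \<rho>"
    proof -
      have "norm (x - z) \<le> 2 * \<rho>"
        using norm_triangle_ineq[of "x - x'" "x' - z"] e q by (simp add: norm_minus_commute)
      then show ?thesis
        using p_pos by simp
    qed
    finally show ?thesis
      using N pos \<rho> by linarith
  qed
  ultimately show ?thesis
    unfolding eps_solution_def x'_def[symmetric] by blast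
qed

section \<open>Convergence rate\<close>

lemma iteration:
  assumes alg: "prox_inexact_alm f A b P \<Gamma> p c \<alpha> \<beta> x y z" and \<beta>: "0 \<le> \<beta>" "\<beta> \<le> 1"
  shows "y (Suc t) = y t + \<alpha> *\<^sub>R (A *v x t - b)"
    and "x (Suc t) = step (x t) (z t) (y (Suc t))"
    and "z (Suc t) = z t + \<beta> *\<^sub>R (x (Suc t) - z t)"
    and "x t \<in> P" and "z t \<in> P"
    and "y t - y 0 \<in> span ((\<lambda>x. A *v x - b) ` P)"
proof -
  show yS: "y (Suc t) = y t + \<alpha> *\<^sub>R (A *v x t - b)" for t
    using alg by (simp add: prox_inexact_alm_def)
  show xS: "x (Suc t) = step (x t) (z t) (y (Suc t))" for t
    using alg by (simp add: prox_inexact_alm_def step_def grad_eqI[OF GDERIV_K])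
  show zS: "z (Suc t) = z t + \<beta> *\<^sub>R (x (Suc t) - z t)" for t
    using alg by (simp add: prox_inexact_alm_def)
  have init: "x 0 \<in> P" "z 0 \<in> P"
    using alg by (simp_all add: prox_inexact_alm_def)
  show xP: "x t \<in> P" for t
    using init(1) by (cases t) (simp_all add: xS step_in_P)
  show "z t \<in> P"
  proof (induction t)
    case (Suc t)
    have "z (Suc t) = (1 - \<beta>) *\<^sub>R z t + \<beta> *\<^sub>R x (Suc t)"
      by (simp add: zS algebra_simps)
    then show ?case
      using convex_P Suc xP[of "Suc t"] \<beta> by (simp add: convex_alt)
  qed (rule init)
  show "y t - y 0 \<in> span ((\<lambda>x. A *v x - b) ` P)"
  proof (induction t)
    case (Suc t)
    have "y (Suc t) - y 0 = (y t - y 0) + \<alpha> *\<^sub>R (A *v x t - b)"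
      by (simp add: yS)
    also have "\<dots> \<in> span ((\<lambda>x. A *v x - b) ` P)"
      by (intro span_add span_scale span_base imageI Suc xP)
    finally show ?case .
  qed (simp add: span_zero)
qed

text \<open>The first bound makes the total decrease finite. The second, read as a lower bound on
  the dual value, is what bounds the multipliers through \<open>dual_coercive\<close>.\<close>

lemma potential_ge:
  assumes "x \<in> P"
  shows "\<phi> x y z \<ge> K (Xs z) z 0" and "\<phi> x y z \<ge> 2 * K (Xs z) z 0 - K (X y z) z y"
  using X_min[OF assms, where y = y and z = z] X_min[OF Xs_in_P[of z], where y = y and z = z]
    K_feasible[OF Xs_feasible[of z], of z y]
  unfolding \<phi>_def by linarith+

text \<open>The constants are fixed in an order that avoids circularity: the level of the potential
  and the multiplier bound \<open>U\<close> depend on the data and \<open>y\<^sub>0\<close> but not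
  on \<beta>, so the threshold for \<beta> can be chosen afterwards. Descent from a given level
  keeps that level, hence the multiplier bound, at the next step.\<close>

lemma convergence_rate:
  assumes \<alpha>: "0 < \<alpha>" "4 * c * \<alpha> * (\<sigma> * (1 + \<kappa>))\<^sup>2 \<le> 1"
  shows "\<exists>\<beta>\<^sub>0>0. \<forall>\<beta>. 0 < \<beta> \<and> \<beta> < \<beta>\<^sub>0 \<and> \<beta> \<le> 1 \<longrightarrow>
    (\<forall>x y z. prox_inexact_alm f A b P \<Gamma> p c \<alpha> \<beta> x y z \<and> y 0 = y\<^sub>0 \<longrightarrow>
      (\<exists>B>0. \<forall>t>0. \<exists>s<t. eps_solution f A b P (B / sqrt (real t)) (x (Suc s)) (y (Suc s))))"
proof -
  obtain B\<^sub>0 where B\<^sub>0: "B\<^sub>0 > 0"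
    "\<And>x y z. norm y \<le> norm y\<^sub>0 \<Longrightarrow> x \<in> P \<Longrightarrow> z \<in> P \<Longrightarrow> \<bar>K x z y\<bar> \<le> B\<^sub>0"
    using K_bounded by blast
  \<comment> \<open>The 7 is 5 + 2: the dual value is at least 2 M minus the potential, with M at
    least \<open>- B\<^sub>0\<close> and the potential at most \<open>5 * B\<^sub>0\<close>.\<close>
  obtain U where U: "\<And>y z. y - y\<^sub>0 \<in> span ((\<lambda>x. A *v x - b) ` P) \<Longrightarrow> z \<in> P \<Longrightarrow>
      K (X y z) z y \<ge> - (7 * B\<^sub>0) \<Longrightarrow> norm y \<le> U"
    using dual_coercive by blast
  obtain R where R: "R > 0" "\<And>x. x \<in> P \<Longrightarrow> norm (A *v x - b) \<le> R"
    using residual_bound by blast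
  \<comment> \<open>The decrease lemma needs a bound on the updated multiplier, which lies one dual
    step of length at most \<alpha> \<open>R\<close> beyond \<open>U\<close>.\<close>
  obtain \<beta>\<^sub>0 where \<beta>\<^sub>0: "\<beta>\<^sub>0 > 0"
    and dec: "\<forall>\<beta> x y z x' y' z'. 0 < \<beta> \<longrightarrow> \<beta> < \<beta>\<^sub>0 \<longrightarrow> \<beta> \<le> 1 \<longrightarrow> x \<in> P \<longrightarrow> z \<in> P \<longrightarrow>
      y' = y + \<alpha> *\<^sub>R (A *v x - b) \<longrightarrow> x' = step x z y' \<longrightarrow> z' = z + \<beta> *\<^sub>R (x' - z) \<longrightarrow>
      norm y' \<le> U + \<alpha> * R \<longrightarrow>
      \<phi> x' y' z' \<le> \<phi> x y z - 1 / (8 * c) * (norm (x' - x))\<^sup>2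
        - \<alpha> / 2 * (norm (A *v X y' z - b))\<^sup>2 - p * \<beta> / 8 * (norm (x' - z))\<^sup>2"
    using potential_sufficient_decrease[OF \<alpha>, of "U + \<alpha> * R"] by (elim exE conjE)
  have M_ge: "K (Xs z) z 0 \<ge> - B\<^sub>0" if "z \<in> P" for z
    using B\<^sub>0(2)[of 0 "Xs z" z] Xs_in_P that by simp
  have main: "\<exists>B>0. \<forall>t>0. \<exists>s<t. eps_solution f A b P (B / sqrt (real t)) (x (Suc s)) (y (Suc s))"
    if \<beta>: "0 < \<beta>" "\<beta> < \<beta>\<^sub>0" "\<beta> \<le> 1"
      and alg: "prox_inexact_alm f A b P \<Gamma> p c \<alpha> \<beta> x y z" and y0: "y 0 = y\<^sub>0" for \<beta> x y z
  proof -
    note it = iteration[OF alg less_imp_le[OF \<beta>(1)] \<beta>(3)]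
    define \<Phi> where "\<Phi> t = \<phi> (x t) (y t) (z t)" for t
    define e r q where "e t = norm (x (Suc t) - x t)"
      and "r t = norm (A *v X (y (Suc t)) (z t) - b)" and "q t = norm (x (Suc t) - z t)" for t
    \<comment> \<open>The weights 1, 2 and 2 of the potential add up to 5.\<close>
    have \<Phi>0: "\<Phi> 0 \<le> 5 * B\<^sub>0"
      using B\<^sub>0(2)[of "y 0" "x 0" "z 0"] B\<^sub>0(2)[of "y 0" "X (y 0) (z 0)" "z 0"]
        B\<^sub>0(2)[of 0 "Xs (z 0)" "z 0"] it(4,5)[of 0] X_in_P[of "y 0" "z 0"] Xs_in_P[of "z 0"]
      by (simp add: \<Phi>_def \<phi>_def y0)
    have descent: "\<Phi> (Suc t) \<le> \<Phi> t - 1 / (8 * c) * (e t)\<^sup>2 - \<alpha> / 2 * (r t)\<^sup>2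
        - p * \<beta> / 8 * (q t)\<^sup>2" if "\<Phi> t \<le> 5 * B\<^sub>0" for t
    proof -
      have "K (X (y t) (z t)) (z t) (y t) \<ge> - (7 * B\<^sub>0)"
        using potential_ge(2)[OF it(4)[of t], where y = "y t" and z = "z t"] M_ge[OF it(5)[of t]] that
        by (simp add: \<Phi>_def)
      then have "norm (y t) \<le> U"
        by (rule U[OF it(6)[of t, unfolded y0] it(5)[of t]])
      moreover have "norm (y (Suc t)) \<le> norm (y t) + \<alpha> * R"
        unfolding it(1) using R(2)[OF it(4)] \<alpha>(1)
        by (intro order_trans[OF norm_triangle_ineq] add_left_mono) (simp add: mult_left_mono)
      ultimately have "norm (y (Suc t)) \<le> U + \<alpha> * R"
        by linarith
      from dec[rule_format, OF \<beta> it(4,5) it(1,2,3) this] show ?thesis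
        unfolding \<Phi>_def e_def r_def q_def .
    qed
    define \<eta> where "\<eta> = min (1 / (8 * c)) (min (\<alpha> / 2) (p * \<beta> / 8))"
    have \<eta>: "\<eta> > 0"
      using c_pos \<alpha>(1) p_pos \<beta>(1) by (simp add: \<eta>_def)
    define a where "a t = (e t)\<^sup>2 + (r t)\<^sup>2 + (q t)\<^sup>2" for t
    have a_nonneg: "a t \<ge> 0" for t
      by (simp add: a_def)
    have dec_a: "\<Phi> (Suc t) \<le> \<Phi> t - \<eta> * a t" if "\<Phi> t \<le> 5 * B\<^sub>0" for t
    proof -
      have "\<eta> * (e t)\<^sup>2 \<le> 1 / (8 * c) * (e t)\<^sup>2" "\<eta> * (r t)\<^sup>2 \<le> \<alpha> / 2 * (r t)\<^sup>2"
        "\<eta> * (q t)\<^sup>2 \<le> p * \<beta> / 8 * (q t)\<^sup>2"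
        by (intro mult_right_mono; simp add: \<eta>_def)+
      then show ?thesis
        using descent[OF that] unfolding a_def distrib_left by linarith
    qed
    \<comment> \<open>The level and the telescoped sum are carried through one induction, since each
      descent step presupposes the level.\<close>
    have sum: "\<Phi> t \<le> 5 * B\<^sub>0 \<and> \<eta> * (\<Sum>s<t. a s) \<le> 5 * B\<^sub>0 - \<Phi> t" for t
    proof (induction t)
      case (Suc t)
      have "\<eta> * a t \<ge> 0"
        using \<eta> a_nonneg by simp
      then show ?case
        using dec_a[of t] Suc by (simp add: distrib_left)
    qed (simp add: \<Phi>0)
    define V where "V = 6 * B\<^sub>0 / \<eta>"
    have "V > 0"
      using B\<^sub>0(1) \<eta> by (simp add: V_def)
    have sum_le: "(\<Sum>s<t. a s) \<le> V" for t
    proof -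
      have "\<Phi> t \<ge> - B\<^sub>0"
        using potential_ge(1)[OF it(4)[of t], where y = "y t" and z = "z t"] M_ge[OF it(5)[of t]]
        by (simp add: \<Phi>_def)
      then have "\<eta> * (\<Sum>s<t. a s) \<le> 6 * B\<^sub>0"
        using sum[of t] by linarith
      then show ?thesis
        using \<eta> by (simp add: V_def pos_le_divide_eq mult.commute)
    qed
    define N where "N = 1 + \<sigma> * \<kappa> + L + 1 / c + \<Gamma> * (\<sigma> * (1 + \<sigma> * (1 + \<kappa>))) + 2 * p"
    have "N > 0"
      using \<sigma>_nonneg \<kappa>_pos L_pos c_pos \<Gamma>_pos p_pos unfolding N_def
      by (intro add_pos_pos add_pos_nonneg mult_nonneg_nonneg) auto
    have "\<exists>s<t. eps_solution f A b P (N * sqrt V / sqrt (real t)) (x (Suc s)) (y (Suc s))"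
      if t: "t > 0" for t
    proof -
      obtain s where s: "s < t" "a s \<le> V / real t"
        using exists_le_average[OF sum_le t] by blast
      define \<rho> where "\<rho> = sqrt (V / real t)"
      have "v \<le> \<rho>" if "v\<^sup>2 \<le> a s" for v
        unfolding \<rho>_def using that s(2) by (intro real_le_rsqrt) linarith
      then have "e s \<le> \<rho>" "r s \<le> \<rho>" "q s \<le> \<rho>"
        by (simp_all add: a_def)
      then have "eps_solution f A b P (N * \<rho>) (x (Suc s)) (y (Suc s))"
        using eps_solution_step[OF it(4)[of s] it(5)[of s], where y = "y (Suc s)" and \<rho> = \<rho>]
        unfolding it(2)[symmetric] N_def e_def r_def q_def by blast
      moreover have "N * \<rho> = N * sqrt V / sqrt (real t)"
        by (simp add: \<rho>_def real_sqrt_divide)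
      ultimately show ?thesis
        using s(1) by metis
    qed
    moreover have "N * sqrt V > 0"
      using \<open>N > 0\<close> \<open>V > 0\<close> by simp
    ultimately show ?thesis
      by blast
  qed
  show ?thesis
    by (rule exI[of _ \<beta>\<^sub>0], intro conjI allI impI \<beta>\<^sub>0, elim conjE, rule main)
qed

text \<open>Supplies the \<open>init\<close> premise of \<open>iteration_complexity_of_rate\<close>;
  zero is a subgradient of the indicator at every point of the box.\<close>

lemma initial_eps_solution:
  assumes "x \<in> P"
  shows "\<exists>\<epsilon>. eps_solution f A b P \<epsilon> x y"
proof -
  let ?g = "grad f x + transpose A *v y + 0"
  have "0 \<in> subdifferential (convex_indicator P) x"
    using assms by (intro indicator_subgradient) auto
  then have "eps_solution f A b P (norm (A *v x - b) + norm ?g) x y"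
    unfolding eps_solution_def by (intro conjI bexI[of _ ?g]) auto
  then show ?thesis
    by blast
qed

end

section \<open>Choice of the dual stepsize and conclusion\<close>

theorem theorem4p2:
  fixes f :: "real^'n \<Rightarrow> real"
    and A :: "real^'n^'m"
    and b :: "real^'m"
    and l u :: "real^'n"
    and P :: "(real^'n) set"
    and L \<gamma> \<Gamma> p \<sigma> L\<^sub>K c :: real
  assumes "\<forall>x. f differentiable (at x)"
    and "P = {x. \<forall>i. l $ i \<le> x $ i \<and> x $ i \<le> u $ i}"
    and "\<forall>i. l $ i < u $ i"
    and "0 \<in> rel_interior ((\<lambda>x. A *v x - b) ` P)"
    and "strict_complementarity f A b l u"
    and "L > 0"
    and "\<forall>x\<in>P. \<forall>x'\<in>P. norm (grad f x - grad f x') \<le> L * norm (x - x')"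
    and "\<forall>x\<in>P. \<forall>x'\<in>P. (grad f x - grad f x') \<bullet> (x - x') \<ge> \<gamma> * (norm (x - x'))\<^sup>2"
    and "\<Gamma> > 0"
    and "p > 0"
    and "p > - \<gamma>"
    and "\<sigma> = onorm (\<lambda>x. A *v x)"
    and "L\<^sub>K = L + p + \<Gamma> * \<sigma>\<^sup>2"
    and "0 < c"
    and "c < 1 / L\<^sub>K"
  shows "\<exists>\<alpha>\<^sub>0>0. \<forall>\<alpha>. 0 < \<alpha> \<and> \<alpha> < \<alpha>\<^sub>0 \<longrightarrow>
    (\<forall>y\<^sub>0. \<exists>\<beta>\<^sub>0>0. \<forall>\<beta>. 0 < \<beta> \<and> \<beta> < \<beta>\<^sub>0 \<and> \<beta> \<le> 1 \<longrightarrow>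
      (\<forall>x y z. prox_inexact_alm f A b P \<Gamma> p c \<alpha> \<beta> x y z \<and> y 0 = y\<^sub>0 \<longrightarrow>
        (\<exists>B>0.
          (\<forall>t>0. \<exists>s<t. eps_solution f A b P (B / sqrt (real t)) (x (Suc s)) (y (Suc s))) \<and>
          (\<forall>\<epsilon>>0. \<exists>k. real k \<le> B\<^sup>2 / \<epsilon>\<^sup>2 \<and> eps_solution f A b P \<epsilon> (x k) (y k)))))"
proof -
  interpret box_problem f A b l u P L \<gamma> \<Gamma> p c
    using assms by unfold_locales auto
  \<comment> \<open>The smallness condition of \<open>convergence_rate\<close> solved for \<alpha>;
    the added 1 keeps the denominator positive when A is zero. The threshold does not depend on
    \<open>y\<^sub>0\<close>.\<close>
  define \<alpha>\<^sub>0 where "\<alpha>\<^sub>0 = 1 / (4 * c * ((onorm ((*v) A) * (1 + \<kappa>))\<^sup>2 + 1))"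
  have \<alpha>\<^sub>0: "\<alpha>\<^sub>0 > 0"
    using c_pos by (simp add: \<alpha>\<^sub>0_def add_nonneg_pos)
  have main: "\<exists>\<beta>\<^sub>0>0. \<forall>\<beta>. 0 < \<beta> \<and> \<beta> < \<beta>\<^sub>0 \<and> \<beta> \<le> 1 \<longrightarrow>
      (\<forall>x y z. prox_inexact_alm f A b P \<Gamma> p c \<alpha> \<beta> x y z \<and> y 0 = y\<^sub>0 \<longrightarrow>
        (\<exists>B>0.
          (\<forall>t>0. \<exists>s<t. eps_solution f A b P (B / sqrt (real t)) (x (Suc s)) (y (Suc s))) \<and>
          (\<forall>\<epsilon>>0. \<exists>k. real k \<le> B\<^sup>2 / \<epsilon>\<^sup>2 \<and> eps_solution f A b P \<epsilon> (x k) (y k))))"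
    if \<alpha>: "0 < \<alpha>" "\<alpha> < \<alpha>\<^sub>0" for \<alpha> y\<^sub>0
  proof -
    let ?s = "(onorm ((*v) A) * (1 + \<kappa>))\<^sup>2"
    have "4 * c * (?s + 1) > 0"
      using c_pos by (simp add: add_nonneg_pos)
    then have "\<alpha> * (4 * c * (?s + 1)) < 1"
      using \<alpha>(2) by (simp only: \<alpha>\<^sub>0_def pos_less_divide_eq)
    moreover have "\<alpha> * (4 * c * (?s + 1)) = 4 * c * \<alpha> * ?s + 4 * c * \<alpha>"
      by (simp add: algebra_simps)
    moreover have "4 * c * \<alpha> > 0"
      using c_pos \<alpha>(1) by simp
    ultimately have "4 * c * \<alpha> * ?s \<le> 1"
      by linarith
    from convergence_rate[OF \<alpha>(1) this, of y\<^sub>0] obtain \<beta>\<^sub>0 where "\<beta>\<^sub>0 > 0"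
      and rate: "\<forall>\<beta>. 0 < \<beta> \<and> \<beta> < \<beta>\<^sub>0 \<and> \<beta> \<le> 1 \<longrightarrow>
        (\<forall>x y z. prox_inexact_alm f A b P \<Gamma> p c \<alpha> \<beta> x y z \<and> y 0 = y\<^sub>0 \<longrightarrow>
          (\<exists>B>0. \<forall>t>0. \<exists>s<t. eps_solution f A b P (B / sqrt (real t)) (x (Suc s)) (y (Suc s))))"
      by (elim exE conjE)
    show ?thesis
    proof (rule exI[of _ \<beta>\<^sub>0], intro conjI allI impI)
      fix \<beta> x y z
      assume \<beta>: "0 < \<beta> \<and> \<beta> < \<beta>\<^sub>0 \<and> \<beta> \<le> 1"
        and alg: "prox_inexact_alm f A b P \<Gamma> p c \<alpha> \<beta> x y z \<and> y 0 = y\<^sub>0"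
      obtain C where C: "C > 0" and sol: "\<And>t. t > 0 \<Longrightarrow>
          \<exists>s<t. eps_solution f A b P (C / sqrt (real t)) (x (Suc s)) (y (Suc s))"
        using rate[rule_format, OF \<beta> alg] by blast
      have "x 0 \<in> P"
        using alg by (simp add: prox_inexact_alm_def)
      then obtain N where N: "eps_solution f A b P N (x 0) (y 0)"
        using initial_eps_solution by blast
      show "\<exists>B>0.
          (\<forall>t>0. \<exists>s<t. eps_solution f A b P (B / sqrt (real t)) (x (Suc s)) (y (Suc s))) \<and>
          (\<forall>\<epsilon>>0. \<exists>k. real k \<le> B\<^sup>2 / \<epsilon>\<^sup>2 \<and> eps_solution f A b P \<epsilon> (x k) (y k))"
        by (rule iteration_complexity_of_rate[where E = "\<lambda>k \<epsilon>. eps_solution f A b P \<epsilon> (x k) (y k)",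
              OF eps_solution_mono C sol N])
    qed (rule \<open>\<beta>\<^sub>0 > 0\<close>)
  qed
  show ?thesis
    by (rule exI[of _ \<alpha>\<^sub>0], intro conjI allI impI \<alpha>\<^sub>0, elim conjE, rule main)
qed

end
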